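(* Let $\mathfrak{n}$ be the necklace Lie algebra in two variables $x,x^*$ with homogeneous components $\mathfrak{n}_n$, viewed as $\mathfrak{sl}_2$-modules. Let $n\ge 1$ and let $0\le m\le\frac n2$ be an integer. Then the highest weight module $V_{n-2m}$ occurs in the decomposition of $\mathfrak{n}_n$ into simple $\mathfrak{sl}_2$-modules with multiplicity $$\binom nm-\binom n{m-1}-\sum_{\ell\mid n\mid \ell m}\frac{\ell-1}{\ell}\sum_{k\mid\gcd(\ell,\frac{\ell}{n}m)}\mu(k)\binom{\ell/k}{\ell m/(kn)}+\sum_{\ell\mid n\mid\ell(m-1)}\frac{\ell-1}{\ell}\sum_{k\mid\gcd(\ell,\frac{\ell}{n}(m-1))}\mu(k)\binom{\ell/k}{\ell(m-1)/(kn)},$$ where $\mu$ is the M\"obius function.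
   Context: Let $A=\mathbb{C}\langle x,x^*\rangle$. The canonical symplectic double bracket on $A$ is the bilinear map $\{\!\{-,-\}\!\}:A\otimes A\to A\otimes A$ determined by $\{\!\{x,x\}\!\}=\{\!\{x^*,x^*\}\!\}=0$, $\{\!\{x,x^*\}\!\}=1\otimes1$, together with $\{\!\{a,b\}\!\}=-\{\!\{b,a\}\!\}^{o}$ (where $(u\otimes v)^o=v\otimes u$) and $\{\!\{a,bc\}\!\}=b\{\!\{a,c\}\!\}+\{\!\{a,b\}\!\}c$ for the outer bimodule structure $a(u\otimes v)c=(au)\otimes(vc)$. With $\mu_A$ the multiplication of $A$, the map $(a,b)\mapsto\mu_A(\{\!\{a,b\}\!\})$ induces a Lie bracket on the vector space quotient $\mathfrak{n}=A/[A,A]$ ($[A,A]$ = span of commutators), the necklace Lie algebra in two variables, graded by word length, with bracket of degree $-2$. The Lie subalgebra $\mathfrak{n}_2$ is identified with $\mathfrak{sl}_2$ via $E=\frac{(x^* )^2}{2}$, $F=-\frac{x^2}{2}$, $H=xx^*$, and acts on each $\mathfrak{n}_n$ by the bracket. $V_j$ denotes the simple $\mathfrak{sl}_2$-module of highest weight $j$ (dimension $j+1$). The outer sums run over positive integers $\ell$ such that $\ell$ divides $n$ and $n$ divides $\ell m$ (respectively $\ell(m-1)$); inner sums run over positive divisors $k$; binomial coefficients with negative lower entry are $0$; $\gcd(\ell,0)=\ell$. *)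

theory Defs
  imports Complex_Main "HOL-Library.FuncSet" "HOL-Library.Poly_Mapping"
    "HOL-Library.Product_Plus" "HOL-Computational_Algebra.Squarefree"
begin

section \<open>The free algebra on two letters\<close>

datatype letter = LX | LXs

datatype xword = Word (letters: "letter list")

text \<open>Words form a monoid under concatenation. It is written additively because the convolution
  product of finitely supported functions is defined in the library for additive monoids.\<close>

instantiation xword :: monoid_add
begin
definition zero_xword :: xword where "0 = Word []"
definition plus_xword :: "xword \<Rightarrow> xword \<Rightarrow> xword"
  where "u + v = Word (letters u @ letters v)"
instance by standard (simp_all add: zero_xword_def plus_xword_def)
end

type_synonym falg = "xword \<Rightarrow>\<^sub>0 complex"

text \<open>The space \<open>A \<otimes> A\<close> has the pairs \<open>(u, v)\<close> of words as a basis, standing for \<open>u \<otimes> v\<close>. Its library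
  ring structure is the tensor product algebra, \<open>(u \<otimes> v) (u' \<otimes> v') = u u' \<otimes> v v'\<close>.\<close>

type_synonym falg2 = "xword \<times> xword \<Rightarrow>\<^sub>0 complex"

definition gen_x :: falg where "gen_x = Poly_Mapping.single (Word [LX]) 1"
definition gen_xs :: falg where "gen_xs = Poly_Mapping.single (Word [LXs]) 1"

definition pscale :: "complex \<Rightarrow> ('a \<Rightarrow>\<^sub>0 complex) \<Rightarrow> ('a \<Rightarrow>\<^sub>0 complex)"
  where "pscale c p = Poly_Mapping.map ((*) c) p"

definition lin_ext :: "('a \<Rightarrow> ('b \<Rightarrow>\<^sub>0 complex)) \<Rightarrow> ('a \<Rightarrow>\<^sub>0 complex) \<Rightarrow> ('b \<Rightarrow>\<^sub>0 complex)"
  where "lin_ext f p = (\<Sum>k\<in>Poly_Mapping.keys p. pscale (Poly_Mapping.lookup p k) (f k))"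

definition tens :: "falg \<Rightarrow> falg \<Rightarrow> falg2"
  where "tens a b = lin_ext (\<lambda>u. lin_ext (\<lambda>v. Poly_Mapping.single (u, v) 1) b) a"

definition flip2 :: "falg2 \<Rightarrow> falg2"
  where "flip2 = lin_ext (\<lambda>(u, v). Poly_Mapping.single (v, u) 1)"

definition mu_A :: "falg2 \<Rightarrow> falg"
  where "mu_A = lin_ext (\<lambda>(u, v). Poly_Mapping.single (u + v) 1)"

definition outer :: "falg \<Rightarrow> falg2 \<Rightarrow> falg \<Rightarrow> falg2"
  where "outer a t c = tens a 1 * t * tens 1 c"

lemma lookup_pscale [simp]: "Poly_Mapping.lookup (pscale c p) k = c * Poly_Mapping.lookup p k"
  by (simp add: pscale_def Poly_Mapping.map.rep_eq when_def)

interpretation pm: vector_space pscale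
  by unfold_locales (auto intro!: poly_mapping_eqI simp: lookup_add algebra_simps)

abbreviation plinear :: "(('a \<Rightarrow>\<^sub>0 complex) \<Rightarrow> ('b \<Rightarrow>\<^sub>0 complex)) \<Rightarrow> bool"
  where "plinear f \<equiv> Vector_Spaces.linear pscale pscale f"

lemma plinear_iff:
  "plinear f \<longleftrightarrow> (\<forall>p q. f (p + q) = f p + f q) \<and> (\<forall>c p. f (pscale c p) = pscale c (f p))"
  by (simp add: Vector_Spaces.linear_def module_hom_def module_hom_axioms_def
      pm.module_axioms pm.vector_space_axioms)

lemma plinear_sum: "plinear f \<Longrightarrow> f (sum g S) = (\<Sum>i\<in>S. f (g i))"
  unfolding Vector_Spaces.linear_def by (blast intro: module_hom.sum)

lemma poly_mapping_expand:
  "p = (\<Sum>k\<in>Poly_Mapping.keys p. pscale (Poly_Mapping.lookup p k) (Poly_Mapping.single k 1))"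
proof (rule poly_mapping_eqI)
  fix k
  have "(\<Sum>i\<in>Poly_Mapping.keys p. Poly_Mapping.lookup p i * Poly_Mapping.lookup (Poly_Mapping.single i 1) k)
     = (\<Sum>i\<in>Poly_Mapping.keys p. if i = k then Poly_Mapping.lookup p i else 0)"
    by (rule sum.cong) (auto simp: lookup_single when_def)
  also have "\<dots> = Poly_Mapping.lookup p k"
    by (simp add: sum.delta in_keys_iff)
  finally show "Poly_Mapping.lookup p k = Poly_Mapping.lookup
      (\<Sum>k\<in>Poly_Mapping.keys p. pscale (Poly_Mapping.lookup p k) (Poly_Mapping.single k 1)) k"
    by (simp add: lookup_sum)
qed

lemma plinear_eqI:
  assumes "plinear f" "plinear g"
    and "\<And>k. f (Poly_Mapping.single k 1) = g (Poly_Mapping.single k 1)"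
  shows "f p = g p"
proof -
  have "f p = (\<Sum>k\<in>Poly_Mapping.keys p. pscale (Poly_Mapping.lookup p k) (f (Poly_Mapping.single k 1)))"
    using assms(1) by (subst poly_mapping_expand[of p]) (simp add: plinear_sum plinear_iff)
  also have "\<dots> = g p"
    using assms(2,3) by (subst (3) poly_mapping_expand[of p]) (simp add: plinear_sum plinear_iff)
  finally show ?thesis .
qed

lemma lin_ext_superset:
  assumes "finite S" "Poly_Mapping.keys p \<subseteq> S"
  shows "lin_ext f p = (\<Sum>k\<in>S. pscale (Poly_Mapping.lookup p k) (f k))"
  unfolding lin_ext_def using assms
  by (intro sum.mono_neutral_left) (auto simp: in_keys_iff)

lemma plinear_lin_ext [simp]: "plinear (lin_ext f)"
proof (unfold plinear_iff, intro conjI allI)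
  fix p q :: "'a \<Rightarrow>\<^sub>0 complex" and c
  let ?S = "Poly_Mapping.keys p \<union> Poly_Mapping.keys q"
  show "lin_ext f (p + q) = lin_ext f p + lin_ext f q"
    using keys_add[of p q]
    by (simp add: lin_ext_superset[of ?S] lookup_add pm.scale_left_distrib sum.distrib)
  show "lin_ext f (pscale c p) = pscale c (lin_ext f p)"
    by (subst lin_ext_superset[of "Poly_Mapping.keys p"])
       (auto simp: in_keys_iff lin_ext_def pm.scale_sum_right)
qed

lemma lin_ext_single [simp]: "lin_ext f (Poly_Mapping.single k 1) = f k"
  by (simp add: lin_ext_def)

lemmas lin_ext_add = plinear_lin_ext[unfolded plinear_iff, THEN conjunct1, rule_format]
lemmas lin_ext_scale = plinear_lin_ext[unfolded plinear_iff, THEN conjunct2, rule_format]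

lemma plinear_lin_ext_fun:
  assumes "\<And>k. plinear (\<lambda>q. f q k)"
  shows "plinear (\<lambda>q. lin_ext (f q) p)"
  using assms unfolding plinear_iff lin_ext_def
  by (simp add: pm.scale_right_distrib sum.distrib pm.scale_sum_right mult.commute)

lemma plinear_comp: "plinear f \<Longrightarrow> plinear g \<Longrightarrow> plinear (\<lambda>p. f (g p))"
  by (simp add: plinear_iff)

lemma plinear_add: "plinear f \<Longrightarrow> plinear g \<Longrightarrow> plinear (\<lambda>p. f p + g p)"
  by (simp add: plinear_iff pm.scale_right_distrib algebra_simps)

lemma plinear_uminus: "plinear f \<Longrightarrow> plinear (\<lambda>p. - f p)"
  by (simp add: plinear_iff)

lemma plinear_id: "plinear (\<lambda>p. p)"
  by (simp add: plinear_iff)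

lemma pscale_eq_mult: "pscale c p = Poly_Mapping.single 0 c * p"
  for p :: "'a::monoid_add \<Rightarrow>\<^sub>0 complex"
  by (simp add: pscale_def mult_map_scale_conv_mult)

lemma pscale_mult_left: "pscale c p * q = pscale c (p * q)"
  for p q :: "'a::monoid_add \<Rightarrow>\<^sub>0 complex"
  by (simp add: pscale_eq_mult mult.assoc)

lemma single_scale: "Poly_Mapping.single k c = pscale c (Poly_Mapping.single k 1)"
  by (rule poly_mapping_eqI) (simp add: lookup_single when_def)

lemma single_zero_commute: "p * Poly_Mapping.single 0 c = Poly_Mapping.single 0 c * p"
  for p :: "'a::monoid_add \<Rightarrow>\<^sub>0 complex"
proof -
  have "(\<Sum>k\<in>Poly_Mapping.keys p. Poly_Mapping.single k (Poly_Mapping.lookup p k)) * Poly_Mapping.single 0 c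
    = Poly_Mapping.single 0 c * (\<Sum>k\<in>Poly_Mapping.keys p. Poly_Mapping.single k (Poly_Mapping.lookup p k))"
    by (simp add: sum_distrib_left sum_distrib_right mult_single mult.commute)
  then show ?thesis
    unfolding single_scale[of _ "Poly_Mapping.lookup p _"] poly_mapping_expand[symmetric] .
qed

lemma pscale_mult_right: "p * pscale c q = pscale c (p * q)"
  for p q :: "'a::monoid_add \<Rightarrow>\<^sub>0 complex"
  by (metis pscale_eq_mult mult.assoc single_zero_commute)

lemma plinear_mult_left: "plinear f \<Longrightarrow> plinear (\<lambda>p. f p * q)"
  for q :: "'a::monoid_add \<Rightarrow>\<^sub>0 complex"
  by (simp add: plinear_iff pscale_mult_left distrib_right)

lemma plinear_mult_right: "plinear f \<Longrightarrow> plinear (\<lambda>p. q * f p)"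
  for q :: "'a::monoid_add \<Rightarrow>\<^sub>0 complex"
  by (simp add: plinear_iff pscale_mult_right distrib_left)

lemma plinear_tens_left: "plinear (\<lambda>a. tens a b)"
  unfolding tens_def by simp

lemma plinear_tens_right: "plinear (\<lambda>b. tens a b)"
  unfolding tens_def by (rule plinear_lin_ext_fun) simp

lemma tens_single [simp]:
  "tens (Poly_Mapping.single u 1) (Poly_Mapping.single v 1) = Poly_Mapping.single (u, v) 1"
  by (simp add: tens_def)

lemma one_eq_single: "1 = (Poly_Mapping.single 0 1 :: 'a::zero \<Rightarrow>\<^sub>0 complex)"
  by simp

lemma tens_one_one: "tens 1 1 = 1"
  unfolding one_eq_single tens_single by (simp add: zero_prod_def)

lemma mu_A_single: "mu_A (Poly_Mapping.single (u, v) 1) = Poly_Mapping.single (u + v) 1"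
  by (simp add: mu_A_def)

lemma flip2_single_one: "flip2 (Poly_Mapping.single (u, v) 1) = Poly_Mapping.single (v, u) 1"
  by (simp add: flip2_def)

lemma mu_A_tens: "mu_A (tens a b) = a * b"
proof -
  have l: "plinear mu_A" by (simp add: mu_A_def)
  show ?thesis
  proof (rule plinear_eqI[of "\<lambda>a. mu_A (tens a b)" "\<lambda>a. a * b"])
    show "plinear (\<lambda>a. mu_A (tens a b))" by (rule plinear_comp[OF l plinear_tens_left])
    show "plinear (\<lambda>a. a * b)" by (rule plinear_mult_left[OF plinear_id])
    fix k
    show "mu_A (tens (Poly_Mapping.single k 1) b) = Poly_Mapping.single k 1 * b"
      by (rule plinear_eqI[of "\<lambda>b. mu_A (tens (Poly_Mapping.single k 1) b)"
            "\<lambda>b. Poly_Mapping.single k 1 * b"])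
         (simp_all add: plinear_comp[OF l plinear_tens_right] plinear_mult_right[OF plinear_id]
           mu_A_single mult_single)
  qed
qed

lemma flip2_tens: "flip2 (tens a b) = tens b a"
proof -
  have l: "plinear flip2" by (simp add: flip2_def)
  show ?thesis
  proof (rule plinear_eqI[of "\<lambda>a. flip2 (tens a b)" "\<lambda>a. tens b a"])
    show "plinear (\<lambda>a. flip2 (tens a b))" by (rule plinear_comp[OF l plinear_tens_left])
    show "plinear (\<lambda>a. tens b a)" by (rule plinear_tens_right)
    fix k
    show "flip2 (tens (Poly_Mapping.single k 1) b) = tens b (Poly_Mapping.single k 1)"
      by (rule plinear_eqI[of "\<lambda>b. flip2 (tens (Poly_Mapping.single k 1) b)"
            "\<lambda>b. tens b (Poly_Mapping.single k 1)"])
         (simp_all add: plinear_comp[OF l plinear_tens_right] plinear_tens_left flip2_single_one)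
  qed
qed

lemma tens_mult: "tens a b * tens a' b' = tens (a * a') (b * b')"
proof -
  have 1: "tens (Poly_Mapping.single u 1) (Poly_Mapping.single v 1) * tens (Poly_Mapping.single u' 1) b'
     = tens (Poly_Mapping.single u 1 * Poly_Mapping.single u' 1) (Poly_Mapping.single v 1 * b')" for u v u' b'
    by (rule plinear_eqI[of "\<lambda>b'. _ * tens _ b'" "\<lambda>b'. tens _ (_ * b')"])
       (simp_all add: plinear_mult_right[OF plinear_tens_right] plinear_comp[OF plinear_tens_right plinear_mult_right[OF plinear_id]] mult_single)
  have 2: "tens (Poly_Mapping.single u 1) (Poly_Mapping.single v 1) * tens a' b'
     = tens (Poly_Mapping.single u 1 * a') (Poly_Mapping.single v 1 * b')" for u v a' b'
    by (rule plinear_eqI[of "\<lambda>a'. _ * tens a' _" "\<lambda>a'. tens (_ * a') _"])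
       (simp_all only: plinear_mult_right[OF plinear_tens_left] plinear_comp[OF plinear_tens_left plinear_mult_right[OF plinear_id]] 1)
  have 3: "tens (Poly_Mapping.single u 1) b * tens a' b'
     = tens (Poly_Mapping.single u 1 * a') (b * b')" for u b a' b'
    by (rule plinear_eqI[of "\<lambda>b. tens _ b * _" "\<lambda>b. tens _ (b * _)"])
       (simp_all only: plinear_mult_left[OF plinear_tens_right] plinear_comp[OF plinear_tens_right plinear_mult_left[OF plinear_id]] 2)
  show ?thesis
    by (rule plinear_eqI[of "\<lambda>a. tens a _ * _" "\<lambda>a. tens (a * _) _"])
       (simp_all only: plinear_mult_left[OF plinear_tens_left] plinear_comp[OF plinear_tens_left plinear_mult_left[OF plinear_id]] 3)
qed

lemma outer_tens: "outer a (tens u v) c = tens (a * u) (v * c)"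
  by (simp add: outer_def tens_mult)


section \<open>The double bracket\<close>

definition is_canonical_double_bracket :: "(falg \<Rightarrow> falg \<Rightarrow> falg2) \<Rightarrow> bool" where
  "is_canonical_double_bracket D \<longleftrightarrow>
     (\<forall>b. plinear (\<lambda>a. D a b)) \<and> (\<forall>a. plinear (\<lambda>b. D a b)) \<and>
     D gen_x gen_x = 0 \<and> D gen_xs gen_xs = 0 \<and> D gen_x gen_xs = tens 1 1 \<and>
     (\<forall>a b. D a b = - flip2 (D b a)) \<and>
     (\<forall>a b c. D a (b * c) = outer b (D a c) 1 + outer 1 (D a b) c)"

lemma canonical_double_bracketD:
  assumes "is_canonical_double_bracket D"
  shows canonical_plinear_left: "plinear (\<lambda>a. D a b)"
    and canonical_plinear_right: "plinear (\<lambda>b. D a b)"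
    and canonical_swap: "D a b = - flip2 (D b a)"
    and canonical_leibniz: "D a (b * c) = outer b (D a c) 1 + outer 1 (D a b) c"
  using assms unfolding is_canonical_double_bracket_def by (blast, blast, metis, blast)

definition double_bracket :: "falg \<Rightarrow> falg \<Rightarrow> falg2"
  where "double_bracket = (THE D. is_canonical_double_bracket D)"

text \<open>An explicit formula, which shows that the bracket exists: each pair of a letter of \<open>w = w\<^sub>1 a w\<^sub>2\<close> and a
  letter of \<open>v = v\<^sub>1 b v\<^sub>2\<close> contributes the multiple of \<open>v\<^sub>1 w\<^sub>2 \<otimes> w\<^sub>1 v\<^sub>2\<close> given by the pairing of \<open>a\<close> and \<open>b\<close>.\<close>

fun letter_pairing :: "letter \<Rightarrow> letter \<Rightarrow> complex" where
  "letter_pairing LX LXs = 1"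
| "letter_pairing LXs LX = -1"
| "letter_pairing _ _ = 0"

definition word_bracket :: "letter list \<Rightarrow> letter list \<Rightarrow> falg2" where
  "word_bracket w v = (\<Sum>i<length w. \<Sum>j<length v.
     Poly_Mapping.single (Word (take j v @ drop (Suc i) w), Word (take i w @ drop (Suc j) v))
       (letter_pairing (w ! i) (v ! j)))"

definition explicit_bracket :: "falg \<Rightarrow> falg \<Rightarrow> falg2" where
  "explicit_bracket a b = lin_ext (\<lambda>w. lin_ext (\<lambda>v. word_bracket (letters w) (letters v)) b) a"

lemma plinear_flip2: "plinear flip2" by (simp add: flip2_def)
lemma plinear_mu_A: "plinear mu_A" by (simp add: mu_A_def)

lemma flip2_single: "flip2 (Poly_Mapping.single (u, v) c) = Poly_Mapping.single (v, u) c"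
  by (subst (1 2) single_scale) (simp add: flip2_def lin_ext_scale)

lemma outer_single:
  "outer (Poly_Mapping.single p 1) (Poly_Mapping.single (u, v) c) (Poly_Mapping.single q 1)
   = Poly_Mapping.single (p + u, v + q) c"
  unfolding outer_def one_eq_single tens_single by (simp add: mult_single)

lemma outer_single_left: "outer (Poly_Mapping.single p 1) (Poly_Mapping.single (u, v) c) 1
   = Poly_Mapping.single (p + u, v) c"
  unfolding one_eq_single outer_single by simp

lemma outer_single_right: "outer 1 (Poly_Mapping.single (u, v) c) (Poly_Mapping.single q 1)
   = Poly_Mapping.single (u, v + q) c"
  unfolding one_eq_single outer_single by simp

lemma plinear_outer_mid: "plinear (\<lambda>t. outer a t c)"
  unfolding outer_def by (intro plinear_mult_left plinear_mult_right plinear_id)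
lemma plinear_outer_left: "plinear (\<lambda>a. outer a t c)"
  unfolding outer_def by (intro plinear_mult_left plinear_tens_left)
lemma plinear_outer_right: "plinear (\<lambda>c. outer a t c)"
  unfolding outer_def by (intro plinear_mult_right plinear_tens_right)

lemma plinear_explicit_left: "plinear (\<lambda>a. explicit_bracket a b)"
  by (simp add: explicit_bracket_def)
lemma plinear_explicit_right: "plinear (\<lambda>b. explicit_bracket a b)"
  unfolding explicit_bracket_def by (rule plinear_lin_ext_fun) simp

lemma explicit_single [simp]:
  "explicit_bracket (Poly_Mapping.single w 1) (Poly_Mapping.single v 1) = word_bracket (letters w) (letters v)"
  by (simp add: explicit_bracket_def)

lemma letter_pairing_swap: "letter_pairing a b = - letter_pairing b a"
  by (cases a; cases b) auto

lemma word_bracket_swap: "word_bracket w v = - flip2 (word_bracket v w)"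
proof -
  have "- flip2 (word_bracket v w) = (\<Sum>i<length v. \<Sum>j<length w.
     Poly_Mapping.single (Word (take i v @ drop (Suc j) w), Word (take j w @ drop (Suc i) v))
       (letter_pairing (w ! j) (v ! i)))"
    unfolding word_bracket_def plinear_sum[OF plinear_flip2] flip2_single sum_negf[symmetric]
      single_uminus[symmetric] letter_pairing_swap[symmetric] ..
  also have "\<dots> = word_bracket w v"
    unfolding word_bracket_def by (rule sum.swap)
  finally show ?thesis by simp
qed

lemma sum_lessThan_add: "(\<Sum>j<m + k. f j) = (\<Sum>j<m. f j) + (\<Sum>j<k. f (m + j))"
  for f :: "nat \<Rightarrow> 'a::comm_monoid_add"
  by (induction k) (simp_all add: add.assoc)

lemma word_bracket_append:
  "word_bracket w (b @ c) = outer (Poly_Mapping.single (Word b) 1) (word_bracket w c) 1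
     + outer 1 (word_bracket w b) (Poly_Mapping.single (Word c) 1)"
proof -
  have A: "outer (Poly_Mapping.single (Word b) 1) (word_bracket w c) 1
    = (\<Sum>i<length w. \<Sum>j<length c.
        Poly_Mapping.single (Word (b @ take j c @ drop (Suc i) w), Word (take i w @ drop (Suc j) c))
          (letter_pairing (w ! i) (c ! j)))"
    unfolding word_bracket_def plinear_sum[OF plinear_outer_mid] outer_single_left
    by (simp add: plus_xword_def)
  have B: "outer 1 (word_bracket w b) (Poly_Mapping.single (Word c) 1)
    = (\<Sum>i<length w. \<Sum>j<length b.
        Poly_Mapping.single (Word (take j b @ drop (Suc i) w), Word (take i w @ drop (Suc j) b @ c))
          (letter_pairing (w ! i) (b ! j)))"
    unfolding word_bracket_def plinear_sum[OF plinear_outer_mid] outer_single_right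
    by (simp add: plus_xword_def)
  show ?thesis
    unfolding A B sum.distrib[symmetric]
    unfolding word_bracket_def length_append sum_lessThan_add
    by (simp add: nth_append add.commute)
qed

lemma explicit_swap: "explicit_bracket a b = - flip2 (explicit_bracket b a)"
proof (rule plinear_eqI[of "\<lambda>a. explicit_bracket a b" "\<lambda>a. - flip2 (explicit_bracket b a)"])
  show "plinear (\<lambda>a. explicit_bracket a b)" by (rule plinear_explicit_left)
  show "plinear (\<lambda>a. - flip2 (explicit_bracket b a))"
    by (rule plinear_uminus[OF plinear_comp[OF plinear_flip2 plinear_explicit_right]])
  fix w
  show "explicit_bracket (Poly_Mapping.single w 1) b = - flip2 (explicit_bracket b (Poly_Mapping.single w 1))"
  proof (rule plinear_eqI[of "\<lambda>b. explicit_bracket _ b" "\<lambda>b. - flip2 (explicit_bracket b _)"])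
    show "plinear (\<lambda>b. explicit_bracket (Poly_Mapping.single w 1) b)" by (rule plinear_explicit_right)
    show "plinear (\<lambda>b. - flip2 (explicit_bracket b (Poly_Mapping.single w 1)))"
      by (rule plinear_uminus[OF plinear_comp[OF plinear_flip2 plinear_explicit_left]])
  qed (simp add: word_bracket_swap[symmetric])
qed

lemma explicit_leibniz:
  "explicit_bracket a (b * c) = outer b (explicit_bracket a c) 1 + outer 1 (explicit_bracket a b) c"
proof -
  let ?s = "\<lambda>w. Poly_Mapping.single w (1::complex)"
  have 1: "explicit_bracket (?s w) (?s u * ?s v)
     = outer (?s u) (explicit_bracket (?s w) (?s v)) 1 + outer 1 (explicit_bracket (?s w) (?s u)) (?s v)" for w u v
    using word_bracket_append[of "letters w" "letters u" "letters v"]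
    by (simp add: mult_single plus_xword_def del: single_one)
  note lins = plinear_add plinear_comp[OF plinear_explicit_right plinear_mult_right[OF plinear_id]]
    plinear_comp[OF plinear_explicit_right plinear_mult_left[OF plinear_id]]
    plinear_comp[OF plinear_outer_mid plinear_explicit_right]
    plinear_comp[OF plinear_outer_mid plinear_explicit_left]
    plinear_outer_left plinear_outer_right plinear_explicit_left
  have 2: "explicit_bracket (?s w) (?s u * c)
     = outer (?s u) (explicit_bracket (?s w) c) 1 + outer 1 (explicit_bracket (?s w) (?s u)) c" for w u c
    by (rule plinear_eqI[of "\<lambda>c. explicit_bracket _ (_ * c)" "\<lambda>c. outer _ (explicit_bracket _ c) 1 + outer 1 _ c"])
      (rule 1 lins)+
  have 3: "explicit_bracket (?s w) (b * c)
     = outer b (explicit_bracket (?s w) c) 1 + outer 1 (explicit_bracket (?s w) b) c" for w b c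
    by (rule plinear_eqI[of "\<lambda>b. explicit_bracket _ (b * _)" "\<lambda>b. outer b _ 1 + outer 1 (explicit_bracket _ b) _"])
      (rule 2 lins)+
  show ?thesis
    by (rule plinear_eqI[of "\<lambda>a. explicit_bracket a _" "\<lambda>a. outer _ (explicit_bracket a _) 1 + outer 1 (explicit_bracket a _) _"])
      (rule 3 lins)+
qed

lemma is_canonical_explicit: "is_canonical_double_bracket explicit_bracket"
  unfolding is_canonical_double_bracket_def
proof (intro conjI allI)
  show "explicit_bracket gen_x gen_x = 0" "explicit_bracket gen_xs gen_xs = 0"
    by (simp_all add: gen_x_def gen_xs_def word_bracket_def)
  have "(Word [], Word []) = (0 :: xword \<times> xword)"
    by (simp add: zero_prod_def zero_xword_def)
  then show "explicit_bracket gen_x gen_xs = tens 1 1"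
    by (simp add: gen_x_def gen_xs_def word_bracket_def tens_one_one)
qed (fact plinear_explicit_left plinear_explicit_right explicit_swap explicit_leibniz)+

lemma is_canonical_unique:
  assumes D: "is_canonical_double_bracket D" and D': "is_canonical_double_bracket D'"
  shows "D = D'"
proof -
  let ?s = "\<lambda>w. Poly_Mapping.single (Word w) (1::complex)"
  have gen: "D (?s [a]) (?s [b]) = D' (?s [a]) (?s [b])" for a b
  proof -
    have *: "E gen_x gen_x = 0 \<and> E gen_xs gen_xs = 0 \<and> E gen_x gen_xs = tens 1 1 \<and> E gen_xs gen_x = - flip2 (tens 1 1)"
      if "is_canonical_double_bracket E" for E
      using that unfolding is_canonical_double_bracket_def by metis
    show ?thesis
      using *[OF D] *[OF D'] unfolding gen_x_def gen_xs_def by (cases a; cases b) (simp_all only:)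
  qed
  have Cons: "?s (a # w) = ?s [a] * ?s w" for a w
    by (simp add: mult_single plus_xword_def)
  have nil: "E a (?s []) = 0" if "is_canonical_double_bracket E" for E a
  proof -
    have one: "?s [] = 1" by (simp add: zero_xword_def[symmetric])
    have "E a (1 * 1) = outer 1 (E a 1) 1 + outer 1 (E a 1) 1"
      using that unfolding is_canonical_double_bracket_def by blast
    then show ?thesis by (simp add: one outer_def tens_one_one)
  qed
  have right: "D a (?s w) = D' a (?s w)"
    if "\<And>b. D a (?s [b]) = D' a (?s [b])" for a w
  proof (induction w)
    case Nil show ?case using nil[OF D] nil[OF D'] by simp
  next
    case (Cons b w)
    have "E a (?s [b] * ?s w) = outer (?s [b]) (E a (?s w)) 1 + outer 1 (E a (?s [b])) (?s w)"
      if "is_canonical_double_bracket E" for E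
      using that unfolding is_canonical_double_bracket_def by blast
    from this[OF D] this[OF D'] show ?case
      by (simp only: \<open>?s (b # w) = ?s [b] * ?s w\<close> Cons.IH that)
  qed
  have gen2: "D (?s w) (?s [b]) = D' (?s w) (?s [b])" for w b
  proof -
    have "D (?s w) (?s [b]) = - flip2 (D (?s [b]) (?s w))"
      "D' (?s w) (?s [b]) = - flip2 (D' (?s [b]) (?s w))"
      using D D' unfolding is_canonical_double_bracket_def by blast+
    with right[OF gen, of b w] show ?thesis by simp
  qed
  have words: "D (Poly_Mapping.single w 1) (Poly_Mapping.single v 1)
      = D' (Poly_Mapping.single w 1) (Poly_Mapping.single v 1)" for w v
    using right[OF gen2, of "letters w" "letters v"] by simp
  show ?thesis
  proof (intro ext)
    fix a b
    show "D a b = D' a b"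
    proof (rule plinear_eqI[of "\<lambda>a. D a b" "\<lambda>a. D' a b"])
      fix w
      show "D (Poly_Mapping.single w 1) b = D' (Poly_Mapping.single w 1) b"
        by (rule plinear_eqI[of "\<lambda>b. D _ b" "\<lambda>b. D' _ b", OF
              canonical_plinear_right[OF D] canonical_plinear_right[OF D'] words])
    qed (fact canonical_plinear_left[OF D] canonical_plinear_left[OF D'])+
  qed
qed

lemma ex1_canonical_double_bracket: "\<exists>!D. is_canonical_double_bracket D"
  using is_canonical_explicit is_canonical_unique by blast

lemma is_canonical_double_bracket: "is_canonical_double_bracket double_bracket"
  unfolding double_bracket_def by (rule theI'[OF ex1_canonical_double_bracket])

lemma double_bracket_eq_explicit: "double_bracket = explicit_bracket"
  using is_canonical_unique[OF is_canonical_double_bracket is_canonical_explicit] .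


section \<open>The necklace Lie algebra\<close>

definition commutator_space :: "falg set"
  where "commutator_space = pm.span {a * b - b * a | a b. True}"

definition comm_equiv :: "falg \<Rightarrow> falg \<Rightarrow> bool"
  where "comm_equiv a b \<longleftrightarrow> a - b \<in> commutator_space"

lemma subspace_commutator_space: "pm.subspace commutator_space"
  by (simp add: commutator_space_def)

lemma commutator_in: "a * b - b * a \<in> commutator_space"
  unfolding commutator_space_def by (rule pm.span_base) auto

lemma equivp_comm_equiv: "equivp comm_equiv"
proof (rule equivpI)
  note S = subspace_commutator_space
  show "reflp comm_equiv"
    using pm.subspace_0[OF S] by (simp add: reflp_def comm_equiv_def)
  show "symp comm_equiv"
    using pm.subspace_neg[OF S] by (fastforce simp: symp_def comm_equiv_def)
  show "transp comm_equiv"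
    using pm.subspace_add[OF S] by (fastforce simp: transp_def comm_equiv_def)
qed

lifting_forget poly_mapping.lifting

text \<open>The quotient \<open>A / [A, A]\<close>.\<close>

quotient_type necklace = falg / comm_equiv
  by (rule equivp_comm_equiv)

lift_definition nclass :: "falg \<Rightarrow> necklace" is "\<lambda>a. a" .

lemma comm_equiv_add: "comm_equiv a a' \<Longrightarrow> comm_equiv b b' \<Longrightarrow> comm_equiv (a + b) (a' + b')"
  unfolding comm_equiv_def add_diff_add by (rule pm.subspace_add[OF subspace_commutator_space])

lemma comm_equiv_uminus: "comm_equiv a a' \<Longrightarrow> comm_equiv (- a) (- a')"
  unfolding comm_equiv_def minus_diff_minus by (rule pm.subspace_neg[OF subspace_commutator_space])

lemma comm_equiv_scale: "comm_equiv a a' \<Longrightarrow> comm_equiv (pscale c a) (pscale c a')"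
  unfolding comm_equiv_def pm.scale_right_diff_distrib[symmetric]
  by (rule pm.subspace_scale[OF subspace_commutator_space])

lemma comm_equiv_refl: "comm_equiv a a"
  by (rule equivp_reflp[OF equivp_comm_equiv])

lemma comm_equiv_eq: "a = b \<Longrightarrow> comm_equiv a b"
  by (simp add: comm_equiv_refl)

instantiation necklace :: ab_group_add
begin
lift_definition zero_necklace :: necklace is "0 :: falg" .
lift_definition plus_necklace :: "necklace \<Rightarrow> necklace \<Rightarrow> necklace" is "(+) :: falg \<Rightarrow> falg \<Rightarrow> falg"
  by (rule comm_equiv_add)
lift_definition uminus_necklace :: "necklace \<Rightarrow> necklace" is "uminus :: falg \<Rightarrow> falg"
  by (rule comm_equiv_uminus)
definition minus_necklace :: "necklace \<Rightarrow> necklace \<Rightarrow> necklace"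
  where "minus_necklace a b = a + - b"
instance
proof
  fix a b c :: necklace
  show "a + b + c = a + (b + c)" by transfer (rule comm_equiv_eq, rule add.assoc)
  show "a + b = b + a" by transfer (rule comm_equiv_eq, rule add.commute)
  show "0 + a = a" by transfer (rule comm_equiv_eq, rule add_0_left)
  show "- a + a = 0" by transfer (rule comm_equiv_eq, rule left_minus)
  show "a - b = a + - b" by (rule minus_necklace_def)
qed
end

lift_definition nscale :: "complex \<Rightarrow> necklace \<Rightarrow> necklace" is "pscale :: complex \<Rightarrow> falg \<Rightarrow> falg"
  by (rule comm_equiv_scale)

interpretation neck: vector_space nscale
proof
  fix c d and a b :: necklace
  show "nscale c (a + b) = nscale c a + nscale c b"
    by transfer (rule comm_equiv_eq, rule pm.scale_right_distrib)
  show "nscale (c + d) a = nscale c a + nscale d a"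
    by transfer (rule comm_equiv_eq, rule pm.scale_left_distrib)
  show "nscale c (nscale d a) = nscale (c * d) a"
    by transfer (rule comm_equiv_eq, rule pm.scale_scale)
  show "nscale 1 a = a" by transfer (rule comm_equiv_eq, rule pm.scale_one)
qed

lemma mu_A_outer_left: "mu_A (outer b t 1) = b * mu_A t"
proof (rule plinear_eqI[of "\<lambda>t. mu_A (outer b t 1)" "\<lambda>t. b * mu_A t"])
  show "plinear (\<lambda>t. mu_A (outer b t 1))" by (rule plinear_comp[OF plinear_mu_A plinear_outer_mid])
  show "plinear (\<lambda>t. b * mu_A t)" by (rule plinear_mult_right[OF plinear_mu_A])
  fix k :: "xword \<times> xword"
  show "mu_A (outer b (Poly_Mapping.single k 1) 1) = b * mu_A (Poly_Mapping.single k 1)"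
    by (cases k) (simp only: tens_single[symmetric] outer_tens mu_A_tens mult.assoc mult_1_right)
qed

lemma mu_A_outer_right: "mu_A (outer 1 t c) = mu_A t * c"
proof (rule plinear_eqI[of "\<lambda>t. mu_A (outer 1 t c)" "\<lambda>t. mu_A t * c"])
  show "plinear (\<lambda>t. mu_A (outer 1 t c))" by (rule plinear_comp[OF plinear_mu_A plinear_outer_mid])
  show "plinear (\<lambda>t. mu_A t * c)" by (rule plinear_mult_left[OF plinear_mu_A])
  fix k :: "xword \<times> xword"
  show "mu_A (outer 1 (Poly_Mapping.single k 1) c) = mu_A (Poly_Mapping.single k 1) * c"
    by (cases k) (simp only: tens_single[symmetric] outer_tens mu_A_tens mult.assoc mult_1_left)
qed

lemma mu_A_flip2: "mu_A (flip2 t) - mu_A t \<in> commutator_space"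
proof -
  note S = subspace_commutator_space
  have "mu_A (flip2 t) - mu_A t = (\<Sum>k\<in>Poly_Mapping.keys t. pscale (Poly_Mapping.lookup t k)
      (mu_A (flip2 (Poly_Mapping.single k 1)) - mu_A (Poly_Mapping.single k 1)))"
    by (subst (1 2) poly_mapping_expand[of t])
       (simp add: plinear_sum[OF plinear_flip2] plinear_sum[OF plinear_mu_A] sum_subtractf
         plinear_flip2[unfolded plinear_iff] plinear_mu_A[unfolded plinear_iff] pm.scale_right_diff_distrib)
  also have "\<dots> \<in> commutator_space"
  proof (intro pm.subspace_sum[OF S] pm.subspace_scale[OF S])
    fix k :: "xword \<times> xword"
    obtain u v where k: "k = (u, v)" by (cases k)
    show "mu_A (flip2 (Poly_Mapping.single k 1)) - mu_A (Poly_Mapping.single k 1) \<in> commutator_space"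
      unfolding k tens_single[symmetric] flip2_tens mu_A_tens by (rule commutator_in)
  qed
  finally show ?thesis .
qed

lemmas db_plinear_left = canonical_plinear_left[OF is_canonical_double_bracket]
lemmas db_plinear_right = canonical_plinear_right[OF is_canonical_double_bracket]
lemmas db_swap = canonical_swap[OF is_canonical_double_bracket]
lemmas db_leibniz = canonical_leibniz[OF is_canonical_double_bracket]

lemma plinear_diff: "plinear f \<Longrightarrow> f (p - q) = f p - f q"
  by (metis plinear_iff add_diff_cancel diff_add_cancel)

lemma mu_A_double_bracket_left_linear: "plinear (\<lambda>a. mu_A (double_bracket a b))"
  by (rule plinear_comp[OF plinear_mu_A db_plinear_left])

lemma mu_A_double_bracket_right_linear: "plinear (\<lambda>b. mu_A (double_bracket a b))"
  by (rule plinear_comp[OF plinear_mu_A db_plinear_right])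

lemma mu_A_double_bracket_leibniz:
  "mu_A (double_bracket a (b * c)) = b * mu_A (double_bracket a c) + mu_A (double_bracket a b) * c"
  unfolding db_leibniz plinear_mu_A[unfolded plinear_iff, THEN conjunct1, rule_format]
    mu_A_outer_left mu_A_outer_right ..

lemma mu_A_double_bracket_right:
  assumes "b \<in> commutator_space"
  shows "mu_A (double_bracket a b) \<in> commutator_space"
proof -
  note S = subspace_commutator_space
  let ?f = "\<lambda>b. mu_A (double_bracket a b)"
  note lin = mu_A_double_bracket_right_linear[of a, unfolded plinear_iff]
  note add = lin[THEN conjunct1, rule_format] and scale = lin[THEN conjunct2, rule_format]
  have sub: "pm.subspace {b. ?f b \<in> commutator_space}"
  proof (rule pm.subspaceI)
    have "?f 0 = 0" using scale[of 0 0] by (simp only: pm.scale_zero_left)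
    then show "0 \<in> {b. ?f b \<in> commutator_space}" using pm.subspace_0[OF S] by simp
  qed (simp_all only: mem_Collect_eq add scale pm.subspace_add[OF S] pm.subspace_scale[OF S])
  have "commutator_space \<subseteq> {b. ?f b \<in> commutator_space}"
    unfolding commutator_space_def
  proof (rule pm.span_minimal[OF _ sub[unfolded commutator_space_def]], safe)
    fix u v :: falg
    have "?f (u * v - v * u) = (u * ?f v - ?f v * u) + (?f u * v - v * ?f u)"
      unfolding plinear_diff[OF mu_A_double_bracket_right_linear] mu_A_double_bracket_leibniz
      by (simp add: algebra_simps)
    also have "\<dots> \<in> commutator_space"
      by (intro pm.subspace_add[OF S] commutator_in)
    finally show "?f (u * v - v * u) \<in> pm.span {a * b - b * a |a b. True}"
      unfolding commutator_space_def .
  qed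
  then show ?thesis using assms by blast
qed

lemma mu_A_double_bracket_left:
  assumes "a \<in> commutator_space"
  shows "mu_A (double_bracket a b) \<in> commutator_space"
proof -
  note S = subspace_commutator_space
  have "mu_A (flip2 (double_bracket b a)) \<in> commutator_space"
    using pm.subspace_add[OF S mu_A_flip2[of "double_bracket b a"] mu_A_double_bracket_right[OF assms, of b]] by simp
  moreover have "mu_A (double_bracket a b) = - mu_A (flip2 (double_bracket b a))"
    using plinear_diff[OF plinear_mu_A, of 0 "flip2 (double_bracket b a)"]
      plinear_diff[OF plinear_mu_A, of 0 0]
    by (subst db_swap) simp
  ultimately show ?thesis using pm.subspace_neg[OF S] by simp
qed

lift_definition nbracket :: "necklace \<Rightarrow> necklace \<Rightarrow> necklace"
  is "\<lambda>a b. mu_A (double_bracket a b)"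
proof -
  fix a a' b b' assume *: "comm_equiv a a'" "comm_equiv b b'"
  note S = subspace_commutator_space
  have "mu_A (double_bracket a b) - mu_A (double_bracket a' b')
     = mu_A (double_bracket (a - a') b) + mu_A (double_bracket a' (b - b'))"
    unfolding plinear_diff[OF mu_A_double_bracket_left_linear]
      plinear_diff[OF mu_A_double_bracket_right_linear] by simp
  also have "\<dots> \<in> commutator_space"
    using * unfolding comm_equiv_def
    by (intro pm.subspace_add[OF S] mu_A_double_bracket_left mu_A_double_bracket_right)
  finally show "comm_equiv (mu_A (double_bracket a b)) (mu_A (double_bracket a' b'))"
    by (simp add: comm_equiv_def)
qed

definition necklace_deg :: "nat \<Rightarrow> necklace set"
  where "necklace_deg n = nclass ` {a. \<forall>w\<in>Poly_Mapping.keys a. length (letters w) = n}"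

definition sl2_E :: necklace where "sl2_E = nclass (pscale (1/2) (gen_xs ^ 2))"
definition sl2_F :: necklace where "sl2_F = nclass (- pscale (1/2) (gen_x ^ 2))"
definition sl2_H :: necklace where "sl2_H = nclass (gen_x * gen_xs)"


section \<open>Modules over \<open>sl\<^sub>2\<close>\<close>

text \<open>An \<open>sl\<^sub>2\<close>-module is given by a subspace \<open>U\<close> and the action of the standard basis; the ambient
  operators \<open>e\<close>, \<open>f\<close>, \<open>h\<close> matter only on \<open>U\<close>.\<close>

definition sl2_module ::
  "(complex \<Rightarrow> 'v::ab_group_add \<Rightarrow> 'v) \<Rightarrow> ('v \<Rightarrow> 'v) \<Rightarrow> ('v \<Rightarrow> 'v) \<Rightarrow> ('v \<Rightarrow> 'v) \<Rightarrow> 'v set \<Rightarrow> bool"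
  where "sl2_module s e f h U \<longleftrightarrow>
    module.subspace s U \<and>
    (\<forall>T\<in>{e, f, h}. T ` U \<subseteq> U \<and> (\<forall>u\<in>U. \<forall>v\<in>U. T (u + v) = T u + T v) \<and>
       (\<forall>c. \<forall>u\<in>U. T (s c u) = s c (T u))) \<and>
    (\<forall>u\<in>U. e (f u) - f (e u) = h u \<and> h (e u) - e (h u) = s 2 (e u) \<and>
       h (f u) - f (h u) = s (-2) (f u))"

definition sl2_simple ::
  "(complex \<Rightarrow> 'v::ab_group_add \<Rightarrow> 'v) \<Rightarrow> ('v \<Rightarrow> 'v) \<Rightarrow> ('v \<Rightarrow> 'v) \<Rightarrow> ('v \<Rightarrow> 'v) \<Rightarrow> 'v set \<Rightarrow> bool"
  where "sl2_simple s e f h W \<longleftrightarrow> sl2_module s e f h W \<and> W \<noteq> {0} \<and>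
    (\<forall>W'\<subseteq>W. sl2_module s e f h W' \<longrightarrow> W' = {0} \<or> W' = W)"

text \<open>Membership in the isomorphism class \<open>V\<^sub>j\<close>: simple of highest weight \<open>j\<close>.\<close>

definition sl2_V ::
  "(complex \<Rightarrow> 'v::ab_group_add \<Rightarrow> 'v) \<Rightarrow> ('v \<Rightarrow> 'v) \<Rightarrow> ('v \<Rightarrow> 'v) \<Rightarrow> ('v \<Rightarrow> 'v) \<Rightarrow> nat \<Rightarrow> 'v set \<Rightarrow> bool"
  where "sl2_V s e f h j W \<longleftrightarrow> sl2_simple s e f h W \<and> vector_space.dim s W = j + 1 \<and>
    (\<exists>v\<in>W. v \<noteq> 0 \<and> e v = 0 \<and> h v = s (of_nat j) v)"

text \<open>An internal direct sum; a set of summands suffices since simple modules are nonzero and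
  hence no summand can be repeated.\<close>

definition sl2_decomposition ::
  "(complex \<Rightarrow> 'v::ab_group_add \<Rightarrow> 'v) \<Rightarrow> ('v \<Rightarrow> 'v) \<Rightarrow> ('v \<Rightarrow> 'v) \<Rightarrow> ('v \<Rightarrow> 'v) \<Rightarrow>
     'v set \<Rightarrow> 'v set set \<Rightarrow> bool"
  where "sl2_decomposition s e f h U \<W> \<longleftrightarrow>
    finite \<W> \<and> (\<forall>W\<in>\<W>. sl2_simple s e f h W \<and> W \<subseteq> U) \<and>
    (\<forall>u\<in>U. \<exists>!c. c \<in> (\<Pi>\<^sub>E W\<in>\<W>. W) \<and> u = (\<Sum>W\<in>\<W>. c W))"


section \<open>The multiplicity formula\<close>

definition moebius_mu :: "nat \<Rightarrow> int"
  where "moebius_mu k = (if squarefree k then (-1) ^ card (prime_factors k) else 0)"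

definition binom_int :: "nat \<Rightarrow> int \<Rightarrow> nat"
  where "binom_int n j = (if j < 0 then 0 else n choose nat j)"

text \<open>The double sum of the formula with \<open>j\<close> in place of \<open>m\<close> or \<open>m - 1\<close>. The lower entry \<open>j\<close> is an
  integer because \<open>j = -1\<close> occurs; all the divisions are exact.\<close>

definition necklace_correction :: "nat \<Rightarrow> int \<Rightarrow> real"
  where "necklace_correction n j =
    (\<Sum>l | l > 0 \<and> l dvd n \<and> int n dvd int l * j.
       (real l - 1) / real l *
       (\<Sum>k | k > 0 \<and> int k dvd gcd (int l) (int l * j div int n).
          of_int (moebius_mu k) * real (binom_int (l div k) (int l * j div (int k * int n)))))"

end

theory Submission
  imports Defs
begin

text \<open>The element \<open>H\<close> acts on a cyclic word of length \<open>n\<close> with \<open>j\<close> letters \<open>x\<close> by the scalar \<open>n - 2 j\<close>, and the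
  cyclic words form a basis of the component of degree \<open>n\<close>. In a direct sum of simple modules, the number of
  summands with a nonzero vector of weight \<open>k\<close> is the dimension of the weight space \<open>k\<close>, and for \<open>k \<ge> 0\<close> a simple
  module has weight \<open>k\<close> but not \<open>k + 2\<close> iff its highest weight is \<open>k\<close>. So the multiplicity of the highest weight
  \<open>n - 2 m\<close> is the number of necklaces with \<open>m\<close> letters \<open>x\<close> minus the number of those with \<open>m - 1\<close>.

  A word of rotation period \<open>l\<close> has a rotation class of size \<open>l\<close>, so the number of necklaces is the number of
  words minus the sum of \<open>(l - 1) / l\<close> over all words. The words fixed by rotation by a divisor \<open>d\<close> of \<open>n\<close> are
  powers of words of length \<open>d\<close>, and Moebius inversion counts those of exact period \<open>l\<close>.\<close>

section \<open>Finite-dimensional \<open>sl\<^sub>2\<close>-modules with integral weights\<close>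

text \<open>That a decomposition exists is part of the claim, so complete reducibility has to be
  proved as well. An elementary proof is possible because \<open>H\<close> is diagonal with integer
  eigenvalues on a finite basis, and weight arguments then take the place of a Casimir element. A
  direct family of simple submodules with the largest number of members must span: if it missed a
  basis vector, one of greatest absolute weight could be changed by an element of the sum into a
  vector killed by the raising operator (for negative weight, by the lowering operator), and the
  string of that vector would be a further summand.

  On the counting side, Moebius inversion runs over all pairs of divisors. The conditions
  \<open>n dvd l m\<close> and \<open>k dvd gcd ...\<close> of the formula only discard terms in
  which the number of words fixed by the rotation is zero.\<close>

locale sl2_action = vector_space scale
  for scale :: "complex \<Rightarrow> 'v::ab_group_add \<Rightarrow> 'v" (infixr "*s" 75) +
  fixes e f h :: "'v \<Rightarrow> 'v"
  assumes add: "e (u + v) = e u + e v" "f (u + v) = f u + f v" "h (u + v) = h u + h v"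
    and scale: "e (c *s u) = c *s e u" "f (c *s u) = c *s f u" "h (c *s u) = c *s h u"
    and ef: "e (f u) - f (e u) = h u"
    and he: "h (e u) - e (h u) = 2 *s e u"
    and hf: "h (f u) - f (h u) = (-2) *s f u"
begin

text \<open>The locale demands linearity and the relations on the whole ambient space, so only the
  stability of the subspace remains to be checked.\<close>

lemma sl2_module_iff:
  "sl2_module scale e f h U \<longleftrightarrow> subspace U \<and> (\<forall>u\<in>U. e u \<in> U \<and> f u \<in> U \<and> h u \<in> U)"
  by (auto simp: sl2_module_def add scale ef he hf)

lemma zero [simp]: "e 0 = 0" "f 0 = 0" "h 0 = 0"
  using scale[of 0 0] by simp_all

lemma additive_sum: "T (\<Sum>i\<in>I. w i) = (\<Sum>i\<in>I. T (w i))" if "T \<in> {e, f, h}"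
  by (induction I rule: infinite_finite_induct) (use that in \<open>auto simp: add\<close>)

lemmas sums = additive_sum[of e, simplified] additive_sum[of f, simplified] additive_sum[of h, simplified]

lemma h_e: "h u = k *s u \<Longrightarrow> h (e u) = (k + 2) *s e u"
  using he[of u] by (simp add: scale diff_eq_eq scale_left_distrib add.commute)

lemma h_f: "h u = k *s u \<Longrightarrow> h (f u) = (k - 2) *s f u"
  using hf[of u] by (simp add: scale diff_eq_eq scale_left_diff_distrib)

section \<open>Weight vectors and weight spaces\<close>

text \<open>Applying \<open>h - a\<close> to the sum removes the component of weight
  \<open>a\<close> and multiplies the others by the nonzero factors \<open>k - a\<close>, which
  makes the induction work. With \<open>W = {0}\<close> this is the independence of eigenvectors for
  distinct eigenvalues.\<close>

lemma weight_components:
  assumes W: "subspace W" "\<And>u. u \<in> W \<Longrightarrow> h u \<in> W"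
    and "finite K" "\<And>k. k \<in> K \<Longrightarrow> h (w k) = k *s w k" "(\<Sum>k\<in>K. w k) \<in> W" "k \<in> K"
  shows "w k \<in> W"
  using assms(3-)
proof (induction K arbitrary: w k rule: finite_induct)
  case (insert a K)
  let ?s = "\<Sum>k\<in>insert a K. w k"
  have "h ?s - a *s ?s = (\<Sum>k\<in>K. (k - a) *s w k)"
    using insert by (simp add: sums add scale_right_distrib scale_left_diff_distrib sum_subtractf scale_sum_right)
  moreover have "h ?s - a *s ?s \<in> W"
    using insert.prems(2) by (intro subspace_diff[OF W(1)] subspace_scale[OF W(1)] W(2))
  ultimately have "(\<Sum>k\<in>K. (k - a) *s w k) \<in> W" by simp
  then have *: "(k - a) *s w k \<in> W" if "k \<in> K" for k
    using insert.IH[of "\<lambda>k. (k - a) *s w k" k] insert.prems(1) that by (simp add: scale mult.commute)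
  have K: "w k \<in> W" if "k \<in> K" for k
  proof -
    have "k - a \<noteq> 0" using that insert by auto
    then have "w k = inverse (k - a) *s ((k - a) *s w k)" by simp
    then show ?thesis using *[OF that] subspace_scale[OF W(1)] by metis
  qed
  have "w a = ?s - (\<Sum>k\<in>K. w k)" using insert by simp
  also have "\<dots> \<in> W" by (intro subspace_diff[OF W(1)] subspace_sum[OF W(1)] K insert.prems(2))
  finally show ?case using K insert.prems(3) by blast
qed simp

lemma span_weight_decomp:
  assumes B: "finite B" "\<And>b. b \<in> B \<Longrightarrow> h b = wt b *s b" and u: "u \<in> span B"
  obtains w where "u = (\<Sum>k\<in>wt ` B. w k)" "\<And>k. w k \<in> span {b\<in>B. wt b = k}" "\<And>k. h (w k) = k *s w k"
proof -
  obtain c where c: "u = (\<Sum>b\<in>B. c b *s b)" using u span_finite[OF B(1)] by auto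
  show ?thesis
  proof (rule that)
    show "u = (\<Sum>k\<in>wt ` B. \<Sum>b\<in>{b\<in>B. wt b = k}. c b *s b)"
      unfolding c by (rule sum.image_gen[OF B(1)])
    show "(\<Sum>b\<in>{b\<in>B. wt b = k}. c b *s b) \<in> span {b\<in>B. wt b = k}" for k
      by (intro span_sum span_scale span_base)
    show "h (\<Sum>b\<in>{b\<in>B. wt b = k}. c b *s b) = k *s (\<Sum>b\<in>{b\<in>B. wt b = k}. c b *s b)" for k
      by (simp add: sums scale B(2) scale_sum_right mult.commute)
  qed
qed

lemma weight_vector_in_span:
  assumes B: "finite B" "\<And>b. b \<in> B \<Longrightarrow> h b = wt b *s b" and u: "u \<in> span B" "h u = k *s u"
  shows "u \<in> span {b\<in>B. wt b = k}"
proof -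
  obtain w where w: "u = (\<Sum>k\<in>wt ` B. w k)" "\<And>k. w k \<in> span {b\<in>B. wt b = k}" "\<And>k. h (w k) = k *s w k"
    using span_weight_decomp[OF B u(1)] by metis
  \<comment> \<open>The difference of two expansions of \<open>u\<close> into weight vectors: the
    one grouped from the basis, and \<open>u\<close> itself placed in weight \<open>k\<close>. It
    sums to 0, so every component vanishes. Inserting \<open>k\<close> into the index set covers the
    case that no basis vector has this weight.\<close>
  define w' where "w' j = (if j \<in> wt ` B then w j else 0) - (if j = k then u else 0)" for j
  have "w' k \<in> {0}"
  proof (rule weight_components[of _ "insert k (wt ` B)" w'])
    have "(\<Sum>j\<in>insert k (wt ` B). if j \<in> wt ` B then w j else 0) = u"
      using B(1) by (subst w(1), intro sum.mono_neutral_cong_right) auto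
    moreover have "(\<Sum>j\<in>insert k (wt ` B). if j = k then u else 0) = u"
      using B(1) by (subst sum.delta) auto
    ultimately show "(\<Sum>j\<in>insert k (wt ` B). w' j) \<in> {0}"
      by (simp add: w'_def sum_subtractf del: sum.insert)
    fix j
    have "h (- v) = - h v" for v using scale(3)[of "-1" v] by simp
    then have hd: "h (a - b) = h a - h b" for a b using add(3)[of a "- b"] by simp
    show "h (w' j) = j *s w' j"
      using u(2) w(3)[of j] by (auto simp: w'_def hd scale_right_diff_distrib)
  qed (use B in \<open>auto simp: subspace_0 subspace_def\<close>)
  then have "u = (if k \<in> wt ` B then w k else 0)" by (simp add: w'_def)
  then show ?thesis using w(2)[of k] span_zero by metis
qed

section \<open>Strings generated by highest weight vectors\<close>

definition string :: "'v \<Rightarrow> nat \<Rightarrow> 'v set"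
  where "string v l = span ((\<lambda>i. (f ^^ i) v) ` {..l})"

text \<open>The exact point at which the powers of \<open>f\<close> kill \<open>v\<close> is built
  in, so the facts about strings hold in an ambient space of any dimension;
  \<open>hwv_of_primitive\<close> supplies it from finitely many weights.\<close>

definition hwv :: "'v \<Rightarrow> nat \<Rightarrow> bool"
  where "hwv v l \<longleftrightarrow> e v = 0 \<and> h v = of_nat l *s v \<and> (\<forall>i. (f ^^ i) v = 0 \<longleftrightarrow> l < i)"

lemma h_pow_f: "h v = k *s v \<Longrightarrow> h ((f ^^ i) v) = (k - 2 * of_nat i) *s (f ^^ i) v"
proof (induction i)
  case (Suc i)
  show ?case using h_f[OF Suc.IH[OF Suc.prems]] by (simp add: algebra_simps)
qed simp

text \<open>Each exchange of \<open>e\<close> with \<open>f\<close> adds one eigenvalue of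
  \<open>h\<close>, and \<open>k + (k - 2) + ... + (k - 2 i) = (i + 1) (k - i)\<close>.\<close>

lemma e_pow_f:
  assumes "e v = 0" "h v = k *s v"
  shows "e ((f ^^ Suc i) v) = (of_nat (Suc i) * (k - of_nat i)) *s (f ^^ i) v"
proof (induction i)
  case 0
  show ?case using ef[of v] assms by simp
next
  case (Suc i)
  let ?u = "(f ^^ Suc i) v"
  have "e (f ?u) = f (e ?u) + h ?u" using ef[of ?u] by (simp add: diff_eq_eq add.commute)
  also have "\<dots> = (of_nat (Suc i) * (k - of_nat i)) *s ?u + (k - 2 * of_nat (Suc i)) *s ?u"
    unfolding Suc.IH h_pow_f[OF assms(2)] by (simp add: scale)
  also have "\<dots> = (of_nat (Suc (Suc i)) * (k - of_nat (Suc i))) *s ?u"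
    unfolding scale_left_distrib[symmetric] by (simp add: algebra_simps)
  finally show ?case by simp
qed

context
  fixes v l assumes v: "hwv v l"
begin

lemma hwv_nonzero: "v \<noteq> 0"
  using v unfolding hwv_def by (metis funpow_0 not_less0)

lemma hwv_h: "h ((f ^^ i) v) = of_int (int l - 2 * int i) *s (f ^^ i) v"
  using h_pow_f[of v "of_nat l" i] v by (simp add: hwv_def)

lemma hwv_e: "e ((f ^^ Suc i) v) = (of_nat (Suc i) * (of_nat l - of_nat i)) *s (f ^^ i) v"
  using e_pow_f[of v "of_nat l" i] v by (simp add: hwv_def)

lemma hwv_in_string: "(f ^^ i) v \<in> string v l"
proof (cases "i \<le> l")
  case True then show ?thesis unfolding string_def by (intro span_base) auto
next
  case False
  then have "(f ^^ i) v = 0" using v by (auto simp: hwv_def)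
  then show ?thesis by (simp add: string_def span_zero)
qed

lemma hwv_string_minimal:
  assumes "sl2_module scale e f h W" "v \<in> W"
  shows "string v l \<subseteq> W"
proof -
  have "(f ^^ i) v \<in> W" for i
    using assms by (induction i) (auto simp: sl2_module_iff)
  then show ?thesis using assms unfolding string_def sl2_module_iff by (intro span_minimal) auto
qed

lemma sl2_module_string: "sl2_module scale e f h (string v l)"
proof -
  have gen: "\<forall>u\<in>string v l. T u \<in> string v l"
    if T: "T \<in> {e, f, h}" and g: "\<And>i. T ((f ^^ i) v) \<in> string v l" for T
  proof
    fix u assume "u \<in> string v l"
    then show "T u \<in> string v l"
      unfolding string_def[of v l, THEN eq_reflection]
    proof (induction rule: span_induct_alt)
      case base
      show ?case using T zero by (auto simp: span_zero)
    next
      case (step c x y)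
      then show ?case using T g unfolding string_def by (auto simp: add scale intro!: span_add span_scale)
    qed
  qed
  have 1: "e ((f ^^ i) v) \<in> string v l" for i
  proof (cases i)
    case 0 then show ?thesis using v by (simp add: hwv_def string_def span_zero)
  next
    case (Suc j) show ?thesis unfolding Suc hwv_e
      using hwv_in_string[of j] unfolding string_def by (intro span_scale)
  qed
  have 2: "h ((f ^^ i) v) \<in> string v l" for i
    unfolding hwv_h using hwv_in_string[of i] unfolding string_def by (intro span_scale)
  have 3: "f ((f ^^ i) v) \<in> string v l" for i
    using hwv_in_string[of "Suc i"] by simp
  show ?thesis unfolding sl2_module_iff using gen[of e, OF _ 1] gen[of h, OF _ 2] gen[of f, OF _ 3]
    by (auto simp: string_def)
qed

text \<open>The weights \<open>l - 2 i\<close> along the string are pairwise distinct, so a weight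
  vector involves only one power of \<open>f\<close>.\<close>

lemma string_weight:
  assumes u: "u \<in> string v l" "h u = of_int k *s u" "u \<noteq> 0"
  obtains i c where "i \<le> l" "k = int l - 2 * int i" "u = c *s (f ^^ i) v"
proof -
  \<comment> \<open>\<open>weight_vector_in_span\<close> takes the weight as a function of the basis
    vector, not of its index; \<open>ix\<close> recovers an index from the vector.\<close>
  define ix where "ix b = (SOME i. i \<le> l \<and> b = (f ^^ i) v)" for b
  let ?B = "(\<lambda>i. (f ^^ i) v) ` {..l}"
  let ?wt = "\<lambda>b. of_int (int l - 2 * int (ix b)) :: complex"
  let ?C = "{b\<in>?B. ?wt b = of_int k}"
  have ix: "ix b \<le> l \<and> b = (f ^^ ix b) v" if "b \<in> ?B" for b
    unfolding ix_def by (rule someI_ex) (use that in auto)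
  have C: "u \<in> span ?C"
  proof (rule weight_vector_in_span)
    show "h b = ?wt b *s b" if "b \<in> ?B" for b
      using hwv_h[of "ix b"] ix[OF that] by metis
  qed (use u in \<open>auto simp: string_def\<close>)
  have "?C \<noteq> {}" using C u(3) by (metis span_empty singletonD)
  then obtain b where b: "b \<in> ?B" "k = int l - 2 * int (ix b)"
    unfolding of_int_eq_iff by blast
  have "?C \<subseteq> {b}"
  proof
    fix b' assume b': "b' \<in> ?C"
    then have "int l - 2 * int (ix b') = k" unfolding of_int_eq_iff by blast
    then have "ix b' = ix b" using b by simp
    then show "b' \<in> {b}" using ix[of b] ix[of b'] b b' by (metis (mono_tags, lifting) mem_Collect_eq singletonI)
  qed
  then have "u \<in> span {b}" using C span_mono by blast
  then obtain c where "u = c *s b" by (auto simp: span_singleton)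
  then show ?thesis using that[of "ix b" c] ix[OF b(1)] b(2) by metis
qed

lemma dim_string: "dim (string v l) = l + 1"
proof -
  let ?B = "(\<lambda>i. (f ^^ i) v) ` {..l}"
  have wt_eq: "i = j" if "(f ^^ i) v = (f ^^ j) v" "i \<le> l" for i j
  proof -
    have nz: "(f ^^ i) v \<noteq> 0" using that(2) v by (auto simp: hwv_def)
    have "of_int (int l - 2 * int i) *s (f ^^ i) v = of_int (int l - 2 * int j) *s (f ^^ i) v"
      using hwv_h[of i] hwv_h[of j] that(1) by metis
    then have "(of_int (int l - 2 * int i) :: complex) = of_int (int l - 2 * int j)"
      using nz scale_right_imp_eq by blast
    then show "i = j" unfolding of_int_eq_iff by simp
  qed
  have inj: "inj_on (\<lambda>i. (f ^^ i) v) {..l}"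
    by (rule inj_onI) (use wt_eq in auto)
  have "independent ?B"
  proof (rule independent_if_scalars_zero)
    fix g x assume s: "(\<Sum>x\<in>?B. g x *s x) = 0" and x: "x \<in> ?B"
    \<comment> \<open>The linear combination is reindexed by weights, so that
      \<open>weight_components\<close> with the zero subspace shows each term to be 0. The choice is
      harmless because a weight determines \<open>i\<close>.\<close>
    define w where "w k = (let i = SOME i. k = of_int (int l - 2 * int i) in g ((f ^^ i) v) *s (f ^^ i) v)" for k :: complex
    have w: "w (of_int (int l - 2 * int i)) = g ((f ^^ i) v) *s (f ^^ i) v" for i
    proof -
      have "(SOME j. (of_int (int l - 2 * int i)::complex) = of_int (int l - 2 * int j)) = i"
        by (rule some_equality) (unfold of_int_eq_iff, auto)
      then show ?thesis unfolding w_def Let_def by simp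
    qed
    let ?K = "(\<lambda>i. of_int (int l - 2 * int i) :: complex) ` {..l}"
    have injK: "inj_on (\<lambda>i. of_int (int l - 2 * int i) :: complex) {..l}"
      by (rule inj_onI) (unfold of_int_eq_iff, simp)
    have "(\<Sum>k\<in>?K. w k) = 0"
      unfolding sum.reindex[OF injK] o_def w using s unfolding sum.reindex[OF inj] o_def .
    moreover have "h (w k) = k *s w k" if "k \<in> ?K" for k
      using that w hwv_h by (auto simp: scale mult.commute)
    ultimately have "w k \<in> {0}" if "k \<in> ?K" for k
      using weight_components[of "{0}" ?K w k] that by (auto simp: subspace_def)
    moreover obtain i where i: "i \<le> l" "x = (f ^^ i) v" using x by auto
    ultimately have "g x *s x = 0" using w[of i] by auto
    moreover have "x \<noteq> 0" using i v by (auto simp: hwv_def)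
    ultimately show "g x = 0" by simp
  qed simp
  then show ?thesis
    unfolding string_def using inj by (simp add: dim_eq_card_independent card_image)
qed

end

end

section \<open>Direct sums of simple submodules\<close>

definition direct_family :: "'v::comm_monoid_add set set \<Rightarrow> bool"
  where "direct_family \<W> \<longleftrightarrow>
    (\<forall>c. (\<forall>W\<in>\<W>. c W \<in> W) \<and> (\<Sum>W\<in>\<W>. c W) = 0 \<longrightarrow> (\<forall>W\<in>\<W>. c W = 0))"

lemma direct_familyD:
  assumes "direct_family \<W>" "\<And>W. W \<in> \<W> \<Longrightarrow> c W \<in> W" "(\<Sum>W\<in>\<W>. c W) = 0" "W \<in> \<W>"
  shows "c W = 0"
  using assms unfolding direct_family_def by blast

definition family_sum :: "'v::comm_monoid_add set set \<Rightarrow> 'v set"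
  where "family_sum \<W> = {(\<Sum>W\<in>\<W>. c W) |c. \<forall>W\<in>\<W>. c W \<in> W}"

context sl2_action
begin

lemma minus: "e (- u) = - e u" "f (- u) = - f u" "h (- u) = - h u"
  using scale[of "-1" u] by simp_all

lemma diff: "e (u - v) = e u - e v" "f (u - v) = f u - f v" "h (u - v) = h u - h v"
  unfolding diff_conv_add_uminus by (simp_all only: add minus)

text \<open>The powers \<open>(f ^^ i) v\<close> have the distinct weights \<open>k - 2 i\<close>,
  of which only finitely many occur, so some power vanishes. If the first to vanish is number
  \<open>l + 1\<close>, then applying \<open>e\<close> to it gives \<open>(l + 1) (k - l)\<close>
  times the nonzero \<open>(f ^^ l) v\<close>, which forces \<open>k = l\<close>.\<close>

lemma hwv_of_primitive:
  assumes B: "finite B" "\<And>b. b \<in> B \<Longrightarrow> h b = of_int (wt b) *s b"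
    and U: "sl2_module scale e f h U" "U \<subseteq> span B"
    and v: "v \<in> U" "v \<noteq> 0" "e v = 0" "h v = of_int k *s v"
  shows "hwv v (nat k)" "k \<ge> 0"
proof -
  have mem: "(f ^^ i) v \<in> U" for i
    using U(1) v(1) by (induction i) (auto simp: sl2_module_iff)
  have wt: "h ((f ^^ i) v) = of_int (k - 2 * int i) *s (f ^^ i) v" for i
    using h_pow_f[OF v(4), of i] by simp
  have "\<exists>i. (f ^^ i) v = 0"
  proof (rule ccontr)
    assume no: "\<not> ?thesis"
    have "k - 2 * int i \<in> wt ` B" for i
    proof -
      have "(f ^^ i) v \<in> span {b\<in>B. (of_int (wt b) :: complex) = of_int (k - 2 * int i)}"
        by (rule weight_vector_in_span[OF B _ wt]) (use mem U(2) in auto)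
      then have "{b\<in>B. (of_int (wt b) :: complex) = of_int (k - 2 * int i)} \<noteq> {}"
        using no by (metis span_empty singletonD)
      then obtain b where "b \<in> B" "wt b = k - 2 * int i" unfolding of_int_eq_iff by blast
      then show ?thesis by (metis imageI)
    qed
    then have "range (\<lambda>i. k - 2 * int i) \<subseteq> wt ` B" by auto
    then have "finite (range (\<lambda>i. k - 2 * int i))" using B(1) finite_subset by blast
    moreover have "inj (\<lambda>i. k - 2 * int i)" by (rule injI) simp
    ultimately show False using finite_imageD by blast
  qed
  then obtain N where N: "(f ^^ N) v = 0" "\<And>i. i < N \<Longrightarrow> (f ^^ i) v \<noteq> 0"
    using exists_least_iff[of "\<lambda>i. (f ^^ i) v = 0"] by blast
  obtain l where l: "N = Suc l" using N(1) v(2) by (cases N) auto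
  have "(of_nat (Suc l) * (of_int k - of_nat l)) *s (f ^^ l) v = 0"
    using e_pow_f[OF v(3,4), of l] N(1) unfolding l by simp
  then have "(of_int k :: complex) = of_int (int l)"
    using N(2)[of l] l by (simp del: of_nat_Suc)
  then have k: "k = int l" unfolding of_int_eq_iff .
  have "(f ^^ i) v = 0" if "l < i" for i
  proof -
    have "(f ^^ (j + N)) v = 0" for j using N(1) by (induction j) auto
    moreover have "i = (i - N) + N" using that l by simp
    ultimately show ?thesis by metis
  qed
  then have "(f ^^ i) v = 0 \<longleftrightarrow> l < i" for i
    using N(2)[of i] l by (metis less_Suc_eq_le not_less)
  then show "hwv v (nat k)" "k \<ge> 0"
    using v k unfolding hwv_def by auto
qed

text \<open>Finitely many weights occur in \<open>W\<close>, and \<open>e\<close> would raise a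
  weight vector of the greatest one beyond it, hence kills it.\<close>

lemma exists_hwv:
  assumes B: "finite B" "\<And>b. b \<in> B \<Longrightarrow> h b = of_int (wt b) *s b"
    and W: "sl2_module scale e f h W" "W \<subseteq> span B" "W \<noteq> {0}"
  shows "\<exists>v l. v \<in> W \<and> hwv v l"
proof -
  have subsp: "subspace W" using W(1) by (simp add: sl2_module_iff)
  define K where "K = {k. \<exists>u\<in>W. u \<noteq> 0 \<and> h u = of_int k *s u}"
  have "K \<subseteq> wt ` B"
  proof
    fix k assume "k \<in> K"
    then obtain u where u: "u \<in> W" "u \<noteq> 0" "h u = of_int k *s u" unfolding K_def by auto
    have "u \<in> span {b\<in>B. (of_int (wt b) :: complex) = of_int k}"
      by (rule weight_vector_in_span[OF B _ u(3)]) (use u W(2) in auto)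
    then have "{b\<in>B. (of_int (wt b) :: complex) = of_int k} \<noteq> {}"
      using u(2) by (metis span_empty singletonD)
    then show "k \<in> wt ` B" unfolding of_int_eq_iff by auto
  qed
  then have fin: "finite K" using B(1) finite_subset by blast
  have "K \<noteq> {}"
  proof -
    obtain u where u: "u \<in> W" "u \<noteq> 0" using W(3) subspace_0[OF subsp] by auto
    let ?wt = "\<lambda>b. of_int (wt b) :: complex"
    obtain w where w: "u = (\<Sum>k\<in>?wt ` B. w k)" "\<And>k. h (w k) = k *s w k"
      using span_weight_decomp[of B ?wt u] B u(1) W(2) by (metis subsetD)
    obtain k where k: "k \<in> ?wt ` B" "w k \<noteq> 0"
      using u(2) w(1) by (metis sum.neutral)
    have "w k \<in> W"
      using weight_components[OF subsp, of "?wt ` B" w k] W(1) w u(1) k(1) B(1)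
      by (auto simp: sl2_module_iff)
    then show ?thesis using k w(2)[of k] unfolding K_def by blast
  qed
  then have "Max K \<in> K" using fin by simp
  then obtain u where u: "u \<in> W" "u \<noteq> 0" "h u = of_int (Max K) *s u" unfolding K_def by auto
  have "e u = 0"
  proof (rule ccontr)
    assume "e u \<noteq> 0"
    moreover have "h (e u) = of_int (Max K + 2) *s e u" using h_e[OF u(3)] by simp
    moreover have "e u \<in> W" using u(1) W(1) by (simp add: sl2_module_iff)
    ultimately have "Max K + 2 \<in> K" unfolding K_def by blast
    then show False using Max_ge[OF fin, of "Max K + 2"] by simp
  qed
  then show ?thesis using hwv_of_primitive[OF B W(1,2) u(1,2) _ u(3)] u(1) by blast
qed

text \<open>A nonzero submodule contains a highest weight vector, which is a multiple of some
  \<open>(f ^^ i) v\<close>. For \<open>0 < i \<le> l\<close> the vector \<open>(f ^^ i) v\<close>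
  is not killed by \<open>e\<close>, so \<open>i = 0\<close>; the submodule contains
  \<open>v\<close> and with it the whole string.\<close>

lemma sl2_simple_string:
  assumes B: "finite B" "\<And>b. b \<in> B \<Longrightarrow> h b = of_int (wt b) *s b"
    and v: "hwv v l" "string v l \<subseteq> span B"
  shows "sl2_simple scale e f h (string v l)"
proof -
  have "string v l \<subseteq> W" if W: "W \<subseteq> string v l" "sl2_module scale e f h W" "W \<noteq> {0}" for W
  proof -
    obtain u k where u: "u \<in> W" "hwv u k"
      using exists_hwv[OF B W(2)] W v(2) by blast
    have "u \<in> string v l" "h u = of_int (int k) *s u"
      using u W(1) by (auto simp: hwv_def)
    then obtain i c where ic: "i \<le> l" "u = c *s (f ^^ i) v"
      by (rule string_weight[OF v(1) _ _ hwv_nonzero[OF u(2)]])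
    have c: "c \<noteq> 0" using ic hwv_nonzero[OF u(2)] by auto
    have "i = 0"
    proof (cases i)
      case (Suc j)
      have "e u = 0" using u(2) by (simp add: hwv_def)
      then have "(of_nat (Suc j) * (of_nat l - of_nat j)) *s (f ^^ j) v = 0"
        using hwv_e[OF v(1), of j] ic(2) c Suc by (simp add: scale del: of_nat_Suc)
      moreover have "(f ^^ j) v \<noteq> 0" using v(1) ic(1) Suc by (auto simp: hwv_def)
      ultimately show ?thesis using ic(1) Suc by (simp del: of_nat_Suc)
    qed simp
    then have "v = inverse c *s u" using ic(2) c by simp
    then have "v \<in> W" using u(1) W(2) subspace_scale by (auto simp: sl2_module_iff)
    then show ?thesis using hwv_string_minimal[OF v(1) W(2)] by simp
  qed
  moreover have "string v l \<noteq> {0}"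
    using hwv_in_string[OF v(1), of 0] hwv_nonzero[OF v(1)] by auto
  ultimately show ?thesis
    unfolding sl2_simple_def using sl2_module_string[OF v(1)] by blast
qed

lemma sl2_simple_eq_string:
  assumes B: "finite B" "\<And>b. b \<in> B \<Longrightarrow> h b = of_int (wt b) *s b"
    and W: "sl2_simple scale e f h W" "W \<subseteq> span B"
  obtains v l where "hwv v l" "W = string v l"
proof -
  have W': "sl2_module scale e f h W" "W \<noteq> {0}" using W(1) by (auto simp: sl2_simple_def)
  obtain v l where v: "v \<in> W" "hwv v l" using exists_hwv[OF B W'(1) W(2) W'(2)] by blast
  have "string v l \<subseteq> W" by (rule hwv_string_minimal[OF v(2) W'(1) v(1)])
  moreover have "string v l \<noteq> {0}"
    using hwv_in_string[OF v(2), of 0] hwv_nonzero[OF v(2)] by auto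
  ultimately have "string v l = W"
    using W(1) sl2_module_string[OF v(2)] unfolding sl2_simple_def by blast
  then show ?thesis using that v(2) by blast
qed

lemma string_has_weight_iff:
  assumes v: "hwv v l"
  shows "(\<exists>u\<in>string v l. u \<noteq> 0 \<and> h u = of_int k *s u) \<longleftrightarrow> (\<exists>i\<le>l. k = int l - 2 * int i)"
proof
  assume "\<exists>u\<in>string v l. u \<noteq> 0 \<and> h u = of_int k *s u"
  then show "\<exists>i\<le>l. k = int l - 2 * int i" using string_weight[OF v] by metis
next
  assume "\<exists>i\<le>l. k = int l - 2 * int i"
  then obtain i where "i \<le> l" "k = int l - 2 * int i" by auto
  then show "\<exists>u\<in>string v l. u \<noteq> 0 \<and> h u = of_int k *s u"
    using hwv_in_string[OF v, of i] hwv_h[OF v, of i] v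
    by (intro bexI[of _ "(f ^^ i) v"]) (auto simp: hwv_def)
qed

lemma sl2_V_string_iff:
  assumes v: "hwv v l" and W: "sl2_simple scale e f h (string v l)"
  shows "sl2_V scale e f h j (string v l) \<longleftrightarrow> l = j"
  using assms dim_string[OF v] hwv_in_string[OF v, of 0] hwv_nonzero[OF v]
  unfolding sl2_V_def by (auto simp: hwv_def)

text \<open>Subtracting two expansions of the same vector reduces uniqueness to the zero vector.
  Restricting the choice functions to \<open>\<W>\<close> is what makes them unique as
  functions.\<close>

lemma sl2_decomposition_iff:
  assumes "subspace U"
  shows "sl2_decomposition scale e f h U \<W> \<longleftrightarrow>
    finite \<W> \<and> (\<forall>W\<in>\<W>. sl2_simple scale e f h W \<and> W \<subseteq> U) \<and>
    U \<subseteq> family_sum \<W> \<and> direct_family \<W>"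
proof (cases "finite \<W> \<and> (\<forall>W\<in>\<W>. sl2_simple scale e f h W \<and> W \<subseteq> U)")
  case True
  have W: "subspace W" if "W \<in> \<W>" for W
    using True that by (auto simp: sl2_simple_def sl2_module_iff)
  have eq: "(\<forall>u\<in>U. \<exists>!c. c \<in> (\<Pi>\<^sub>E W\<in>\<W>. W) \<and> u = (\<Sum>W\<in>\<W>. c W))
    \<longleftrightarrow> U \<subseteq> family_sum \<W> \<and> direct_family \<W>" (is "?L \<longleftrightarrow> ?R")
  proof
    assume L: ?L
    have "U \<subseteq> family_sum \<W>"
    proof
      fix u assume "u \<in> U"
      then obtain c where "c \<in> (\<Pi>\<^sub>E W\<in>\<W>. W)" "u = (\<Sum>W\<in>\<W>. c W)" using L by blast
      then show "u \<in> family_sum \<W>" unfolding family_sum_def by auto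
    qed
    moreover have "direct_family \<W>"
      unfolding direct_family_def
    proof (intro allI impI, elim conjE)
      fix c assume c: "\<forall>W\<in>\<W>. c W \<in> W" "(\<Sum>W\<in>\<W>. c W) = 0"
      let ?c = "\<lambda>W\<in>\<W>. c W" and ?z = "\<lambda>W\<in>\<W>. 0"
      have "?c = ?z"
      proof (rule ex1E[OF L[rule_format, OF subspace_0[OF assms]]])
        fix d assume "\<forall>c. c \<in> (\<Pi>\<^sub>E W\<in>\<W>. W) \<and> 0 = (\<Sum>W\<in>\<W>. c W) \<longrightarrow> c = d"
        moreover have "?c \<in> (\<Pi>\<^sub>E W\<in>\<W>. W) \<and> 0 = (\<Sum>W\<in>\<W>. ?c W)" using c by simp
        moreover have "?z \<in> (\<Pi>\<^sub>E W\<in>\<W>. W) \<and> 0 = (\<Sum>W\<in>\<W>. ?z W)"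
          using W subspace_0 by simp
        ultimately show ?thesis by metis
      qed
      then show "\<forall>W\<in>\<W>. c W = 0" by (metis restrict_apply')
    qed
    ultimately show ?R by blast
  next
    assume R: ?R
    show ?L
    proof
      fix u assume "u \<in> U"
      then have "u \<in> family_sum \<W>" using R by blast
      then obtain c where c: "\<forall>W\<in>\<W>. c W \<in> W" "u = (\<Sum>W\<in>\<W>. c W)"
        unfolding family_sum_def by auto
      show "\<exists>!c. c \<in> (\<Pi>\<^sub>E W\<in>\<W>. W) \<and> u = (\<Sum>W\<in>\<W>. c W)"
      proof (rule ex1I[of _ "\<lambda>W\<in>\<W>. c W"])
        show "(\<lambda>W\<in>\<W>. c W) \<in> (\<Pi>\<^sub>E W\<in>\<W>. W) \<and> u = (\<Sum>W\<in>\<W>. (\<lambda>W\<in>\<W>. c W) W)" using c by simp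
        fix d assume d: "d \<in> (\<Pi>\<^sub>E W\<in>\<W>. W) \<and> u = (\<Sum>W\<in>\<W>. d W)"
        have "c V - d V = 0" if V: "V \<in> \<W>" for V
        proof (rule direct_familyD[of \<W> "\<lambda>V. c V - d V"])
          show "direct_family \<W>" using R by (rule conjunct2)
          show "c V - d V \<in> V" if "V \<in> \<W>" for V
            using that c(1) d by (intro subspace_diff[OF W]) auto
          show "(\<Sum>V\<in>\<W>. c V - d V) = 0" using c(2) d by (simp add: sum_subtractf)
        qed (rule V)
        then show "d = (\<lambda>W\<in>\<W>. c W)"
          using d by (intro extensionalityI[of _ \<W>]) (auto simp: PiE_def)
      qed
    qed
  qed
  show ?thesis unfolding sl2_decomposition_def by (simp only: eq)
qed (auto simp: sl2_decomposition_def)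

text \<open>The operator \<open>h - k\<close> maps each summand to itself and the sum to 0, so
  directness makes it kill every component.\<close>

lemma direct_family_weight:
  assumes "direct_family \<W>" "\<And>W. W \<in> \<W> \<Longrightarrow> sl2_module scale e f h W"
    and "\<And>W. W \<in> \<W> \<Longrightarrow> c W \<in> W" "h (\<Sum>W\<in>\<W>. c W) = k *s (\<Sum>W\<in>\<W>. c W)" "W \<in> \<W>"
  shows "h (c W) = k *s c W"
proof -
  have "h (c W) - k *s c W = 0"
  proof (rule direct_familyD[OF assms(1) _ _ assms(5), of "\<lambda>W. h (c W) - k *s c W"])
    show "h (c W) - k *s c W \<in> W" if "W \<in> \<W>" for W
      using assms(2,3)[OF that] unfolding sl2_module_iff by (simp add: subspace_diff subspace_scale)
    show "(\<Sum>W\<in>\<W>. h (c W) - k *s c W) = 0"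
      using assms(4) by (simp add: sum_subtractf scale_sum_right sums)
  qed
  then show ?thesis by simp
qed

lemma sl2_module_family_sum:
  assumes "\<And>W. W \<in> \<W> \<Longrightarrow> sl2_module scale e f h W"
  shows "sl2_module scale e f h (family_sum \<W>)"
proof -
  have W: "subspace W" "\<And>u. u \<in> W \<Longrightarrow> e u \<in> W \<and> f u \<in> W \<and> h u \<in> W" if "W \<in> \<W>" for W
    using assms[OF that] by (auto simp: sl2_module_iff)
  have "subspace (family_sum \<W>)"
  proof (rule subspaceI)
    show "0 \<in> family_sum \<W>"
      unfolding family_sum_def using W subspace_0 by (auto intro!: exI[of _ "\<lambda>_. 0"])
  next
    fix x y assume "x \<in> family_sum \<W>" "y \<in> family_sum \<W>"
    then obtain c d where "\<forall>W\<in>\<W>. c W \<in> W" "x = (\<Sum>W\<in>\<W>. c W)" "\<forall>W\<in>\<W>. d W \<in> W" "y = (\<Sum>W\<in>\<W>. d W)"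
      unfolding family_sum_def by auto
    then show "x + y \<in> family_sum \<W>"
      unfolding family_sum_def using W subspace_add
      by (auto intro!: exI[of _ "\<lambda>W. c W + d W"] simp: sum.distrib)
  next
    fix x a assume "x \<in> family_sum \<W>"
    then obtain c where "\<forall>W\<in>\<W>. c W \<in> W" "x = (\<Sum>W\<in>\<W>. c W)"
      unfolding family_sum_def by auto
    then show "a *s x \<in> family_sum \<W>"
      unfolding family_sum_def using W subspace_scale
      by (auto intro!: exI[of _ "\<lambda>W. a *s c W"] simp: scale_sum_right)
  qed
  moreover have closed: "T u \<in> family_sum \<W>" if u: "u \<in> family_sum \<W>" and T: "T \<in> {e, f, h}" for T u
  proof -
    obtain c where "\<forall>W\<in>\<W>. c W \<in> W" "u = (\<Sum>W\<in>\<W>. c W)"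
      using u unfolding family_sum_def by auto
    then have "\<forall>W\<in>\<W>. T (c W) \<in> W" "T u = (\<Sum>W\<in>\<W>. T (c W))"
      using W T additive_sum[OF T] by auto
    then show ?thesis unfolding family_sum_def by blast
  qed
  then have "\<forall>u\<in>family_sum \<W>. e u \<in> family_sum \<W> \<and> f u \<in> family_sum \<W> \<and> h u \<in> family_sum \<W>"
    by (intro ballI conjI closed[of _ e] closed[of _ f] closed[of _ h]) auto
  ultimately show ?thesis unfolding sl2_module_iff by (intro conjI)
qed

text \<open>Used twice: with vectors of a fixed weight to count the summands having that weight, and
  with arbitrary nonzero vectors to bound the number of summands by the dimension.\<close>

lemma independent_representatives:
  assumes fin: "finite \<W>" and dir: "direct_family \<W>" and subsp: "\<And>W. W \<in> \<W> \<Longrightarrow> subspace W"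
    and \<V>: "\<V> \<subseteq> \<W>" "\<And>W. W \<in> \<V> \<Longrightarrow> g W \<in> W" "\<And>W. W \<in> \<V> \<Longrightarrow> g W \<noteq> 0"
  shows "inj_on g \<V>" "independent (g ` \<V>)"
proof -
  have fin\<V>: "finite \<V>" using finite_subset[OF \<V>(1) fin] .
  have zero: "c W = 0" if c: "(\<Sum>W\<in>\<V>. c W *s g W) = 0" and W: "W \<in> \<V>" for c W
  proof -
    \<comment> \<open>Directness speaks about all of \<open>\<W>\<close>, so the coefficients are
      extended by 0 outside \<open>\<V>\<close>.\<close>
    let ?c = "\<lambda>W. if W \<in> \<V> then c W *s g W else 0"
    have "?c W = 0"
    proof (rule direct_familyD[OF dir, of ?c])
      have "(\<Sum>W\<in>\<W>. ?c W) = (\<Sum>W\<in>\<V>. c W *s g W)"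
        by (rule sum.mono_neutral_cong_right) (use fin \<V>(1) in auto)
      then show "(\<Sum>W\<in>\<W>. ?c W) = 0" using c by simp
      show "?c V \<in> V" if "V \<in> \<W>" for V
        using subsp[OF that] by (auto intro: subspace_scale subspace_0 \<V>(2))
    qed (use W \<V>(1) in blast)
    then show ?thesis using W \<V>(3)[OF W] by simp
  qed
  show inj: "inj_on g \<V>"
  proof (rule inj_onI, rule ccontr)
    fix W W' assume W: "W \<in> \<V>" "W' \<in> \<V>" "g W = g W'" "W \<noteq> W'"
    define c :: "'v set \<Rightarrow> complex" where "c V = (if V = W then 1 else 0) + (if V = W' then - 1 else 0)" for V
    have "(\<Sum>V\<in>\<V>. c V *s g V) = (\<Sum>V\<in>\<V>. (if V = W then g V else 0)) + (\<Sum>V\<in>\<V>. (if V = W' then - g V else 0))"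
      unfolding sum.distrib[symmetric] by (rule sum.cong) (auto simp: c_def W(4))
    also have "\<dots> = 0" using W fin\<V> by simp
    finally have "c W = 0" using zero W(1) by blast
    then show False using W(4) by (simp add: c_def)
  qed
  show "independent (g ` \<V>)"
  proof (rule independent_if_scalars_zero)
    show "finite (g ` \<V>)" using fin\<V> by simp
    fix c x assume "(\<Sum>x\<in>g ` \<V>. c x *s x) = 0" and x: "x \<in> g ` \<V>"
    then have "(\<Sum>W\<in>\<V>. c (g W) *s g W) = 0" unfolding sum.reindex[OF inj] by (simp add: o_def)
    then show "c x = 0" using zero[of "\<lambda>W. c (g W)"] x by blast
  qed
qed

section \<open>Weight spaces and multiplicities of summands\<close>

text \<open>Two bases of the same weight space are compared: the members of \<open>B\<close> of
  weight \<open>k\<close>, and one vector \<open>g W\<close> from each summand in which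
  \<open>k\<close> occurs. The latter span because a weight space of a string is at most
  one-dimensional.\<close>

lemma card_weight_eq:
  assumes B: "finite B" "\<And>b. b \<in> B \<Longrightarrow> h b = of_int (wt b) *s b" "independent B"
    and U: "sl2_module scale e f h (span B)"
    and \<W>: "sl2_decomposition scale e f h (span B) \<W>"
  shows "card {b\<in>B. wt b = k} = card {W\<in>\<W>. \<exists>u\<in>W. u \<noteq> 0 \<and> h u = of_int k *s u}"
proof -
  let ?B = "{b\<in>B. wt b = k}" and ?\<W> = "{W\<in>\<W>. \<exists>u\<in>W. u \<noteq> 0 \<and> h u = of_int k *s u}"
  have fin: "finite \<W>" and sim: "\<And>W. W \<in> \<W> \<Longrightarrow> sl2_simple scale e f h W"
    and sub: "\<And>W. W \<in> \<W> \<Longrightarrow> W \<subseteq> span B"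
    and sum: "span B \<subseteq> family_sum \<W>" and dir: "direct_family \<W>"
    using \<W> unfolding sl2_decomposition_iff[OF subspace_span] by auto
  have mod: "sl2_module scale e f h W" if "W \<in> \<W>" for W
    using sim[OF that] by (simp add: sl2_simple_def)
  have subsp: "subspace W" if "W \<in> \<W>" for W using mod[OF that] by (simp add: sl2_module_iff)
  have "\<forall>W\<in>?\<W>. \<exists>u. u \<in> W \<and> u \<noteq> 0 \<and> h u = of_int k *s u" by blast
  from bchoice[OF this]
  obtain g where "\<forall>W\<in>?\<W>. g W \<in> W \<and> g W \<noteq> 0 \<and> h (g W) = of_int k *s g W" ..
  then have g: "g W \<in> W \<and> g W \<noteq> 0 \<and> h (g W) = of_int k *s g W" if "W \<in> ?\<W>" for W
    using that by blast
  have one_dim: "\<exists>a. u = a *s g W" if W: "W \<in> \<W>" and u: "u \<in> W" "u \<noteq> 0" "h u = of_int k *s u" for W u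
  proof -
    obtain v l where v: "hwv v l" "W = string v l"
      using sl2_simple_eq_string[OF B(1,2) sim[OF W] sub[OF W]] .
    obtain i c where i: "i \<le> l" "k = int l - 2 * int i" "u = c *s (f ^^ i) v"
      using string_weight[OF v(1), of u k] u v(2) by metis
    have "W \<in> ?\<W>" using W u by blast
    note gW = g[OF this]
    obtain j d where j: "j \<le> l" "k = int l - 2 * int j" "g W = d *s (f ^^ j) v"
      using string_weight[OF v(1), of "g W" k] gW v(2) by metis
    have "j = i" using i j by simp
    moreover have "d \<noteq> 0" using j gW by auto
    ultimately have "u = (c / d) *s g W" using i j by simp
    then show ?thesis by blast
  qed
  note rep = independent_representatives[of \<W> ?\<W> g, OF fin dir subsp]
  have inj: "inj_on g ?\<W>" and ind: "independent (g ` ?\<W>)"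
    using rep g by auto
  have 1: "g ` ?\<W> \<subseteq> span ?B"
  proof
    fix x assume "x \<in> g ` ?\<W>"
    then obtain W where W: "W \<in> ?\<W>" "x = g W" by blast
    have "x \<in> span {b\<in>B. (of_int (wt b) :: complex) = of_int k}"
      by (rule weight_vector_in_span[OF B(1,2)]) (use W g sub in auto)
    then show "x \<in> span ?B" by (simp only: of_int_eq_iff)
  qed
  have 2: "?B \<subseteq> span (g ` ?\<W>)"
  proof
    fix b assume b: "b \<in> ?B"
    then have "b \<in> family_sum \<W>" using sum span_base by blast
    then obtain c where c: "\<And>W. W \<in> \<W> \<Longrightarrow> c W \<in> W" "b = (\<Sum>W\<in>\<W>. c W)"
      unfolding family_sum_def by auto
    have "h b = of_int k *s b" using b B(2) by auto
    then have hc: "h (c W) = of_int k *s c W" if "W \<in> \<W>" for W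
      using direct_family_weight[OF dir mod c(1) _ that] c(2) by simp
    have "c W \<in> span (g ` ?\<W>)" if W: "W \<in> \<W>" for W
    proof (cases "c W = 0")
      case False
      then obtain a where a: "c W = a *s g W" using one_dim[OF W c(1)[OF W] _ hc[OF W]] by blast
      have "W \<in> ?\<W>" using W c(1)[OF W] hc[OF W] False by blast
      then show ?thesis unfolding a by (intro span_scale span_base) blast
    qed (simp add: span_zero)
    then show "b \<in> span (g ` ?\<W>)" unfolding c(2) by (rule span_sum)
  qed
  have "independent ?B" by (rule independent_mono[OF B(3)]) simp
  then have "card ?B \<le> card (g ` ?\<W>)"
    using independent_span_bound[OF _ _ 2] fin by simp
  moreover have "card (g ` ?\<W>) \<le> card ?B"
    using independent_span_bound[OF _ ind 1] B(1) by simp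
  ultimately show ?thesis using card_image[OF inj] by simp
qed

text \<open>Stated additively to avoid truncated subtraction. The two kinds of summands are disjoint
  because a string of highest weight \<open>j\<close> has no weight above \<open>j\<close>.\<close>

lemma card_sl2_V_eq:
  assumes B: "finite B" "\<And>b. b \<in> B \<Longrightarrow> h b = of_int (wt b) *s b" "independent B"
    and U: "sl2_module scale e f h (span B)"
    and \<W>: "sl2_decomposition scale e f h (span B) \<W>"
  shows "card {W\<in>\<W>. sl2_V scale e f h j W} + card {b\<in>B. wt b = int j + 2} = card {b\<in>B. wt b = int j}"
proof -
  define has where "has k W \<longleftrightarrow> (\<exists>u\<in>W. u \<noteq> 0 \<and> h u = of_int k *s u)" for k W
  have fin: "finite \<W>" and sim: "\<And>W. W \<in> \<W> \<Longrightarrow> sl2_simple scale e f h W"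
    and sub: "\<And>W. W \<in> \<W> \<Longrightarrow> W \<subseteq> span B"
    using \<W> unfolding sl2_decomposition_iff[OF subspace_span] by auto
  have *: "has (int j) W \<longleftrightarrow> sl2_V scale e f h j W \<or> has (int j + 2) W"
    "\<not> (sl2_V scale e f h j W \<and> has (int j + 2) W)" if W: "W \<in> \<W>" for W
  proof -
    obtain v l where v: "hwv v l" "W = string v l"
      using sl2_simple_eq_string[OF B(1,2) sim[OF W] sub[OF W]] .
    have V: "sl2_V scale e f h j W \<longleftrightarrow> l = j"
      using sl2_V_string_iff[OF v(1)] sim[OF W] v(2) by simp
    have h: "has k W \<longleftrightarrow> (\<exists>i\<le>l. k = int l - 2 * int i)" for k
      unfolding has_def v(2) by (rule string_has_weight_iff[OF v(1)])
    have "(\<exists>i\<le>l. int j = int l - 2 * int i) \<longleftrightarrow> l = j \<or> (\<exists>i\<le>l. int j + 2 = int l - 2 * int i)" (is "?L \<longleftrightarrow> ?R")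
    proof
      assume ?L
      then obtain i where i: "i \<le> l" "int j = int l - 2 * int i" by blast
      then show ?R by (cases i) (auto intro!: exI[of _ "i - 1"])
    next
      assume ?R
      then consider "l = j" | i where "i \<le> l" "int j + 2 = int l - 2 * int i" by blast
      then show ?L
      proof cases
        case 1 then show ?L by (intro exI[of _ 0]) simp
      next
        case (2 i) then show ?L by (intro exI[of _ "Suc i"]) auto
      qed
    qed
    then show "has (int j) W \<longleftrightarrow> sl2_V scale e f h j W \<or> has (int j + 2) W"
      unfolding h V .
    show "\<not> (sl2_V scale e f h j W \<and> has (int j + 2) W)" unfolding h V by auto
  qed
  have "{W\<in>\<W>. has (int j) W} = {W\<in>\<W>. sl2_V scale e f h j W} \<union> {W\<in>\<W>. has (int j + 2) W}"
    using *(1) by blast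
  moreover have "{W\<in>\<W>. sl2_V scale e f h j W} \<inter> {W\<in>\<W>. has (int j + 2) W} = {}"
    using *(2) by blast
  ultimately have "card {W\<in>\<W>. has (int j) W} = card {W\<in>\<W>. sl2_V scale e f h j W} + card {W\<in>\<W>. has (int j + 2) W}"
    using fin by (simp add: card_Un_disjoint)
  then show ?thesis
    using card_weight_eq[OF B U \<W>] unfolding has_def by simp
qed

section \<open>Complete reducibility\<close>

text \<open>On each summand, \<open>e\<close> maps the weight space \<open>k\<close> onto the weight space \<open>k + 2\<close> if \<open>k \<ge> -1\<close>. Hence \<open>b\<close> can be
  corrected by an element of the family sum to a primitive vector.\<close>

lemma complement_summand:
  assumes B: "finite B" "\<And>b. b \<in> B \<Longrightarrow> h b = of_int (wt b) *s b"
    and U: "sl2_module scale e f h (span B)"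
    and \<W>: "direct_family \<W>" "\<And>W. W \<in> \<W> \<Longrightarrow> sl2_simple scale e f h W \<and> W \<subseteq> span B"
    and b: "b \<in> span B" "b \<notin> family_sum \<W>" "h b = of_int k *s b" "k \<ge> 0" "e b \<in> family_sum \<W>"
  shows "\<exists>W. sl2_simple scale e f h W \<and> W \<subseteq> span B \<and> W \<inter> family_sum \<W> = {0}"
proof -
  have mod: "sl2_module scale e f h W" if "W \<in> \<W>" for W
    using \<W>(2)[OF that] by (simp add: sl2_simple_def)
  note S = sl2_module_family_sum[of \<W>, OF mod]
  have subS: "subspace (family_sum \<W>)" using S by (simp add: sl2_module_iff)
  have S_sub: "family_sum \<W> \<subseteq> span B"
  proof
    fix u assume "u \<in> family_sum \<W>"
    then obtain c where "\<forall>W\<in>\<W>. c W \<in> W" "u = (\<Sum>W\<in>\<W>. c W)"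
      unfolding family_sum_def by auto
    then show "u \<in> span B" using \<W>(2) by (auto intro!: span_sum)
  qed
  obtain c where c: "\<And>W. W \<in> \<W> \<Longrightarrow> c W \<in> W" "e b = (\<Sum>W\<in>\<W>. c W)"
    using b(5) unfolding family_sum_def by auto
  have hc: "h (c W) = of_int (k + 2) *s c W" if "W \<in> \<W>" for W
    by (rule direct_family_weight[OF \<W>(1) mod c(1) _ that]) (use h_e[OF b(3)] c(2) in simp_all)
  have "\<exists>d. d \<in> W \<and> e d = c W \<and> h d = of_int k *s d" if W: "W \<in> \<W>" for W
  proof (cases "c W = 0")
    case True
    have "0 \<in> W" using mod[OF W] subspace_0 by (simp add: sl2_module_iff)
    then show ?thesis using True by (intro exI[of _ 0]) simp
  next
    case False
    obtain v l where v: "hwv v l" "W = string v l"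
      using sl2_simple_eq_string[OF B] \<W>(2)[OF W] by metis
    obtain i a where i: "i \<le> l" "k + 2 = int l - 2 * int i" "c W = a *s (f ^^ i) v"
      using string_weight[OF v(1) _ hc[OF W] False] c(1)[OF W] v(2) by metis
    \<comment> \<open>If \<open>i = l\<close>, then \<open>k + 2 = - l\<close>, against
      \<open>k \<ge> 0\<close>. Hence the factor \<open>?q\<close>, by which \<open>e\<close> brings
      \<open>(f ^^ Suc i) v\<close> back to \<open>(f ^^ i) v\<close>, is nonzero and can be divided
      out.\<close>
    have il: "i < l" using i b(4) by simp
    let ?q = "of_nat (Suc i) * (of_nat l - of_nat i) :: complex"
    have q: "?q \<noteq> 0" using il by (simp del: of_nat_Suc)
    have "(a / ?q) *s (f ^^ Suc i) v \<in> W"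
      using hwv_in_string[OF v(1), of "Suc i"] mod[OF W] subspace_scale unfolding sl2_module_iff v(2) by blast
    moreover have "e ((a / ?q) *s (f ^^ Suc i) v) = c W"
      unfolding scale hwv_e[OF v(1)] i(3) using q by simp
    moreover have "k = int l - 2 * int (Suc i)" using i(2) by simp
    then have "h ((f ^^ Suc i) v) = of_int k *s (f ^^ Suc i) v"
      using hwv_h[OF v(1), of "Suc i"] by metis
    then have "h ((a / ?q) *s (f ^^ Suc i) v) = of_int k *s ((a / ?q) *s (f ^^ Suc i) v)"
      unfolding scale by (simp only: scale_scale mult.commute)
    ultimately show ?thesis by blast
  qed
  then have "\<forall>W\<in>\<W>. \<exists>d. d \<in> W \<and> e d = c W \<and> h d = of_int k *s d" by (rule ballI)
  from bchoice[OF this]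
  obtain d where "\<forall>W\<in>\<W>. d W \<in> W \<and> e (d W) = c W \<and> h (d W) = of_int k *s d W" ..
  then have d: "d W \<in> W \<and> e (d W) = c W \<and> h (d W) = of_int k *s d W" if "W \<in> \<W>" for W
    using that by blast
  define s where "s = (\<Sum>W\<in>\<W>. d W)"
  have sS: "s \<in> family_sum \<W>" unfolding s_def family_sum_def using d by blast
  have es: "e s = e b" and hs: "h s = of_int k *s s"
    unfolding s_def c(2) sums scale_sum_right using d by simp_all
  define v where "v = b - s"
  have v: "v \<in> span B" "v \<noteq> 0" "e v = 0" "h v = of_int k *s v"
    unfolding v_def using b(1,2,3) es hs sS S_sub
    by (auto simp: diff scale_right_diff_distrib intro: span_diff)
  have hw: "hwv v (nat k)" using hwv_of_primitive[OF B U _ v] by simp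
  have W: "string v (nat k) \<subseteq> span B" by (rule hwv_string_minimal[OF hw U v(1)])
  have sim: "sl2_simple scale e f h (string v (nat k))" by (rule sl2_simple_string[OF B hw W])
  let ?I = "string v (nat k) \<inter> family_sum \<W>"
  have "sl2_module scale e f h ?I"
    using S sl2_module_string[OF hw] by (auto simp: sl2_module_iff intro: subspace_inter)
  then have "?I = {0} \<or> ?I = string v (nat k)" using sim unfolding sl2_simple_def by blast
  moreover have "v \<notin> family_sum \<W>"
    using subspace_add[OF subS _ sS, of v] b(2) by (auto simp: v_def)
  moreover have "v \<in> string v (nat k)" using hwv_in_string[OF hw, of 0] by simp
  ultimately have "?I = {0}" by blast
  then show ?thesis using sim W by blast
qed

text \<open>The symmetry that exchanges raising and lowering and reverses the weights. It keeps the
  submodules and the simple ones, so basis vectors of negative weight are handled by the argument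
  for nonnegative weight.\<close>

lemma sl2_action_opposite: "sl2_action scale f e (\<lambda>v. - h v)"
proof unfold_locales
  fix u
  show "f (e u) - e (f u) = - h u" using ef[of u] by (metis minus_diff_eq)
  show "- h (f u) - f (- h u) = 2 *s f u" using hf[of u] by (simp add: minus algebra_simps)
  show "- h (e u) - e (- h u) = (-2) *s e u" using he[of u] by (simp add: minus algebra_simps)
qed (simp_all add: add scale)

lemma sl2_module_opposite: "sl2_module scale f e (\<lambda>v. - h v) U \<longleftrightarrow> sl2_module scale e f h U"
  unfolding sl2_action.sl2_module_iff[OF sl2_action_opposite] sl2_module_iff
  using subspace_neg by (metis minus_minus)

lemma sl2_simple_opposite: "sl2_simple scale f e (\<lambda>v. - h v) U \<longleftrightarrow> sl2_simple scale e f h U"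
  unfolding sl2_simple_def sl2_module_opposite ..

lemma direct_family_insert:
  assumes \<W>: "finite \<W>" "direct_family \<W>" "\<And>V. V \<in> insert W \<W> \<Longrightarrow> subspace V"
    and W: "W \<inter> family_sum \<W> = {0}" "W \<notin> \<W>"
  shows "direct_family (insert W \<W>)"
  unfolding direct_family_def
proof (intro allI impI, elim conjE)
  fix c assume c: "\<forall>V\<in>insert W \<W>. c V \<in> V" "(\<Sum>V\<in>insert W \<W>. c V) = 0"
  have eq: "c W = (\<Sum>V\<in>\<W>. - c V)"
    using c(2) \<W>(1) W(2) by (simp add: sum_negf eq_neg_iff_add_eq_0)
  have "\<forall>V\<in>\<W>. - c V \<in> V" using c(1) \<W>(3) subspace_neg by auto
  then have "c W \<in> family_sum \<W>" unfolding eq family_sum_def by blast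
  then have cW: "c W = 0" using c(1) W(1) by blast
  then have "(\<Sum>V\<in>\<W>. c V) = 0" using c(2) \<W>(1) W(2) by simp
  then have "c V = 0" if "V \<in> \<W>" for V
    using direct_familyD[OF \<W>(2) _ _ that, of c] c(1) by simp
  then show "\<forall>V\<in>insert W \<W>. c V = 0" using cW by simp
qed

text \<open>This bound makes a direct family of largest size exist.\<close>

lemma card_direct_family_le:
  assumes "finite B" "finite \<W>" "direct_family \<W>"
    and \<W>: "\<And>W. W \<in> \<W> \<Longrightarrow> sl2_simple scale e f h W \<and> W \<subseteq> span B"
  shows "card \<W> \<le> card B"
proof -
  have subsp: "subspace W" if "W \<in> \<W>" for W
    using \<W>[OF that] by (simp add: sl2_simple_def sl2_module_iff)
  have "\<forall>W\<in>\<W>. \<exists>u. u \<in> W \<and> u \<noteq> 0"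
  proof
    fix W assume W: "W \<in> \<W>"
    then have "W \<noteq> {0}" using \<W> by (simp add: sl2_simple_def)
    then show "\<exists>u. u \<in> W \<and> u \<noteq> 0" using subspace_0[OF subsp[OF W]] by blast
  qed
  from bchoice[OF this] obtain g where "\<forall>W\<in>\<W>. g W \<in> W \<and> g W \<noteq> 0" ..
  then have g: "g W \<in> W" "g W \<noteq> 0" if "W \<in> \<W>" for W using that by simp_all
  have inj: "inj_on g \<W>" and "independent (g ` \<W>)"
    using independent_representatives[of \<W> \<W> g, OF assms(2,3) subsp] g by auto
  moreover have "g ` \<W> \<subseteq> span B" using g \<W> by blast
  ultimately show ?thesis
    using independent_span_bound[OF assms(1)] card_image[OF inj] by metis
qed

lemma exists_sl2_decomposition:
  assumes B: "finite B" "\<And>b. b \<in> B \<Longrightarrow> h b = of_int (wt b) *s b"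
    and U: "sl2_module scale e f h (span B)"
  shows "\<exists>\<W>. sl2_decomposition scale e f h (span B) \<W>"
proof -
  define P where "P \<W> \<longleftrightarrow> finite \<W> \<and> direct_family \<W> \<and>
    (\<forall>W\<in>\<W>. sl2_simple scale e f h W \<and> W \<subseteq> span B)" for \<W>
  have "P {}" by (simp add: P_def direct_family_def)
  moreover have "\<forall>\<W>. P \<W> \<longrightarrow> card \<W> < Suc (card B)"
    unfolding P_def using card_direct_family_le[OF B(1)] by (auto simp: less_Suc_eq_le)
  ultimately obtain \<W> where \<W>: "P \<W>" "\<And>\<V>. P \<V> \<Longrightarrow> card \<V> \<le> card \<W>"
    using ex_has_greatest_nat[of P "{}" card "Suc (card B)"] by blast
  have fin: "finite \<W>" and dir: "direct_family \<W>"
    and sim: "\<And>W. W \<in> \<W> \<Longrightarrow> sl2_simple scale e f h W \<and> W \<subseteq> span B"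
    using \<W>(1) by (auto simp: P_def)
  have S: "sl2_module scale e f h (family_sum \<W>)"
    by (rule sl2_module_family_sum) (use sim in \<open>auto simp: sl2_simple_def\<close>)
  have subS: "subspace (family_sum \<W>)" using S by (simp add: sl2_module_iff)
  have max: False if W: "sl2_simple scale e f h W" "W \<subseteq> span B" "W \<inter> family_sum \<W> = {0}" for W
  proof -
    have "W \<notin> \<W>"
    proof
      assume "W \<in> \<W>"
      have "W \<subseteq> family_sum \<W>"
      proof
        fix u assume u: "u \<in> W"
        have "0 \<in> V" if "V \<in> \<W>" for V
          using sim[OF that] subspace_0 by (auto simp: sl2_simple_def sl2_module_iff)
        moreover have "u = (\<Sum>V\<in>\<W>. if V = W then u else 0)"
          using fin \<open>W \<in> \<W>\<close> by simp
        ultimately show "u \<in> family_sum \<W>" unfolding family_sum_def using u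
          by (auto intro!: exI[of _ "\<lambda>V. if V = W then u else 0"])
      qed
      then show False using W by (auto simp: sl2_simple_def)
    qed
    moreover have "direct_family (insert W \<W>)"
      by (rule direct_family_insert) (use fin dir sim W \<open>W \<notin> \<W>\<close> in \<open>auto simp: sl2_simple_def sl2_module_iff\<close>)
    then have "P (insert W \<W>)" using fin sim W by (auto simp: P_def)
    ultimately show False using \<W>(2)[of "insert W \<W>"] fin by simp
  qed
  have "B \<subseteq> family_sum \<W>"
  proof (rule ccontr)
    assume "\<not> ?thesis"
    then have "B - family_sum \<W> \<noteq> {}" "finite (B - family_sum \<W>)" using B(1) by auto
    then obtain b where b: "b \<in> B - family_sum \<W>"
      and far: "\<And>b'. b' \<in> B - family_sum \<W> \<Longrightarrow> \<bar>wt b'\<bar> \<le> \<bar>wt b\<bar>"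
      using obtains_MAX[of "B - family_sum \<W>" "\<lambda>b. \<bar>wt b\<bar>"] by (metis Max_ge finite_imageI imageI)
    \<comment> \<open>As \<open>\<bar>wt b\<bar>\<close> is maximal outside the sum, the operator moving \<open>b\<close> away from weight 0 sends it into the sum.\<close>
    have bU: "b \<in> span B" using b span_base by blast
    have shift: "u \<in> family_sum \<W>" if u: "u \<in> span B" "h u = of_int k *s u" "\<bar>k\<bar> > \<bar>wt b\<bar>" for u k
    proof -
      have "u \<in> span {b\<in>B. (of_int (wt b) :: complex) = of_int k}"
        by (rule weight_vector_in_span[OF B u(1,2)])
      moreover have "{b\<in>B. (of_int (wt b) :: complex) = of_int k} \<subseteq> family_sum \<W>"
        unfolding of_int_eq_iff using far u(3) by fastforce
      ultimately show ?thesis using span_minimal[OF _ subS] by blast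
    qed
    have hb: "h b = of_int (wt b) *s b" using b B(2) by blast
    have "e b \<in> span B" "f b \<in> span B" using bU U by (auto simp: sl2_module_iff)
    show False
    proof (cases "wt b \<ge> 0")
      case True
      have "e b \<in> family_sum \<W>"
        by (rule shift[OF \<open>e b \<in> span B\<close>, of "wt b + 2"]) (use h_e[OF hb] True in auto)
      then show False
        using complement_summand[OF B U dir sim bU _ hb True] b max by blast
    next
      case False
      have fb: "f b \<in> family_sum \<W>"
        by (rule shift[OF \<open>f b \<in> span B\<close>, of "wt b - 2"]) (use h_f[OF hb] False in auto)
      \<comment> \<open>For the opposite action \<open>f\<close> is the raising operator and
        \<open>b\<close> has the positive weight \<open>- wt b\<close>, so the same construction of
        a new summand applies.\<close>
      interpret opp: sl2_action scale f e "\<lambda>v. - h v" by (rule sl2_action_opposite)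
      have "\<exists>W. sl2_simple scale f e (\<lambda>v. - h v) W \<and> W \<subseteq> span B \<and> W \<inter> family_sum \<W> = {0}"
        by (rule opp.complement_summand[of B "\<lambda>b. - wt b" \<W> b "- wt b"])
          (use B U dir sim bU b hb False fb in \<open>auto simp: sl2_module_opposite sl2_simple_opposite\<close>)
      then show False using max by (auto simp: sl2_simple_opposite)
    qed
  qed
  then have "span B \<subseteq> family_sum \<W>" by (rule span_minimal[OF _ subS])
  then show ?thesis
    using sl2_decomposition_iff[OF subspace_span, of B \<W>] fin dir sim by blast
qed

end

section \<open>Moebius inversion\<close>

lemma moebius_mu_prime_mult:
  assumes p: "prime p" "\<not> p dvd k" and k: "k > 0"
  shows "moebius_mu (p * k) = - moebius_mu k"
proof -
  have cop: "coprime p k" using p prime_imp_coprime by blast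
  have "squarefree (p * k) \<longleftrightarrow> squarefree k"
    using squarefree_mult_coprime[OF cop] squarefree_prime[OF p(1)] squarefree_multD by blast
  moreover have "prime_factors (p * k) = insert p (prime_factors k)"
    using p k by (subst prime_factorization_mult) (auto simp: prime_factorization_prime prime_gt_0_nat)
  moreover have "p \<notin> prime_factors k" using p(2) by auto
  ultimately show ?thesis by (simp add: moebius_mu_def)
qed

text \<open>For a prime \<open>p\<close> dividing \<open>n\<close>, a divisor \<open>k\<close> prime
  to \<open>p\<close> cancels against \<open>p * k\<close>, if \<open>k\<close> runs over all such
  divisors. What remains are the divisors that are multiples of the square of \<open>p\<close>,
  where the function is 0.\<close>

lemma sum_moebius_mu:
  assumes "n > 0"
  shows "(\<Sum>k | k dvd n. moebius_mu k) = (if n = 1 then 1 else 0)"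
proof (cases "n = 1")
  case True
  then show ?thesis by (simp add: moebius_mu_def)
next
  case False
  then obtain p where p: "prime p" "p dvd n" using prime_factor_nat by blast
  have fin: "finite {k. k dvd n}" using assms by simp
  define A where "A = {k. k dvd n \<and> \<not> p dvd k}"
  define B where "B = {k. k dvd n \<and> p dvd k}"
  have pos: "k > 0" if "k dvd n" for k using that assms by (auto intro: Nat.gr0I)
  have "(\<Sum>k\<in>B. moebius_mu k) = (\<Sum>k\<in>(*) p ` A. moebius_mu k)"
  proof (rule sum.mono_neutral_right)
    show "finite B" unfolding B_def using fin by (rule rev_finite_subset) auto
    show "(*) p ` A \<subseteq> B"
      unfolding A_def B_def using p by (auto intro: divides_mult prime_imp_coprime)
    show "\<forall>k\<in>B - (*) p ` A. moebius_mu k = 0"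
    proof
      fix k assume k: "k \<in> B - (*) p ` A"
      then obtain j where j: "k = p * j" unfolding B_def by (auto elim: dvdE)
      have "j dvd n" using k j dvd_mult_right unfolding B_def by blast
      then have "p dvd j" using k j unfolding A_def by auto
      then have "p\<^sup>2 dvd k" unfolding j power2_eq_square by simp
      then have "\<not> squarefree k" using p(1) unfolding squarefree_def by (auto dest: not_prime_unit)
      then show "moebius_mu k = 0" by (simp add: moebius_mu_def)
    qed
  qed
  also have "\<dots> = (\<Sum>k\<in>A. moebius_mu (p * k))"
    using p(1) by (subst sum.reindex) (auto intro!: inj_onI simp: o_def)
  also have "\<dots> = - (\<Sum>k\<in>A. moebius_mu k)"
    unfolding sum_negf[symmetric] using moebius_mu_prime_mult[OF p(1)] pos
    by (intro sum.cong) (auto simp: A_def)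
  finally have "(\<Sum>k\<in>A. moebius_mu k) + (\<Sum>k\<in>B. moebius_mu k) = 0" by simp
  moreover have "{k. k dvd n} = A \<union> B" "A \<inter> B = {}" by (auto simp: A_def B_def)
  moreover have "finite A" "finite B"
    using finite_subset[OF _ fin, of A] finite_subset[OF _ fin, of B] by (auto simp: A_def B_def)
  ultimately show ?thesis using False by (simp add: sum.union_disjoint)
qed

text \<open>After interchanging the sums, the coefficient of \<open>g l\<close> is the Moebius sum
  over the divisors of \<open>n div l\<close>, which vanishes unless \<open>l = n\<close>.\<close>

lemma moebius_inversion:
  fixes g :: "nat \<Rightarrow> 'a::comm_ring_1"
  assumes "n > 0" and f: "\<And>d. d dvd n \<Longrightarrow> f d = (\<Sum>l | l dvd d. g l)"
  shows "(\<Sum>k | k dvd n. of_int (moebius_mu k) * f (n div k)) = g n"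
proof -
  let ?D = "{k. k dvd n}"
  have fin: "finite ?D" using assms(1) by simp
  \<comment> \<open>The condition \<open>k * l dvd n\<close> is symmetric, so this describes the
    inner index set both before and after the interchange.\<close>
  have R: "{l. l dvd n div k} = {l \<in> ?D. k * l dvd n}" if k: "k dvd n" for k
  proof -
    have "k > 0" using k assms(1) by (auto intro: Nat.gr0I)
    then show ?thesis
      using k by (auto simp: dvd_div_iff_mult mult.commute intro: dvd_mult_right elim: dvdE)
  qed
  have "(\<Sum>k\<in>?D. of_int (moebius_mu k) * f (n div k))
      = (\<Sum>k\<in>?D. \<Sum>l\<in>{l\<in>?D. k * l dvd n}. of_int (moebius_mu k) * g l)"
  proof (intro sum.cong refl)
    fix k assume k: "k \<in> ?D"
    then have "n div k dvd n" by (metis dvd_mult_div_cancel dvd_triv_right mem_Collect_eq)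
    then have "f (n div k) = (\<Sum>l\<in>{l\<in>?D. k * l dvd n}. g l)" using f R k by simp
    then show "of_int (moebius_mu k) * f (n div k) = (\<Sum>l\<in>{l\<in>?D. k * l dvd n}. of_int (moebius_mu k) * g l)"
      by (simp add: sum_distrib_left)
  qed
  also have "\<dots> = (\<Sum>l\<in>?D. \<Sum>k\<in>{k\<in>?D. k * l dvd n}. of_int (moebius_mu k) * g l)"
    by (rule sum.swap_restrict[OF fin fin])
  also have "\<dots> = (\<Sum>l\<in>?D. of_int (\<Sum>k | k dvd n div l. moebius_mu k) * g l)"
  proof (intro sum.cong refl)
    fix l assume "l \<in> ?D"
    then have "{k\<in>?D. k * l dvd n} = {k. k dvd n div l}" using R[of l] by (auto simp: mult.commute)
    then show "(\<Sum>k\<in>{k\<in>?D. k * l dvd n}. of_int (moebius_mu k) * g l)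
        = of_int (\<Sum>k | k dvd n div l. moebius_mu k) * g l"
      by (simp add: sum_distrib_right)
  qed
  also have "\<dots> = (\<Sum>l\<in>?D. if l = n then g n else 0)"
  proof (intro sum.cong refl)
    fix l assume "l \<in> ?D"
    then obtain k where k: "n = l * k" by auto
    then have "n div l = k" "k > 0" "l > 0" using assms(1) by auto
    then show "of_int (\<Sum>k | k dvd n div l. moebius_mu k) * g l = (if l = n then g n else 0)"
      using sum_moebius_mu[of k] k by auto
  qed
  also have "\<dots> = g n" using fin by simp
  finally show ?thesis .
qed

section \<open>Words up to rotation\<close>

definition orbit :: "'a list \<Rightarrow> 'a list set"
  where "orbit w = range (\<lambda>i. rotate i w)"

definition period :: "'a list \<Rightarrow> nat"
  where "period w = (LEAST d. d > 0 \<and> rotate d w = w)"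

lemma orbit_refl: "w \<in> orbit w"
  unfolding orbit_def by (rule range_eqI[of _ _ 0]) simp

lemma orbit_eq: "v \<in> orbit w \<longleftrightarrow> orbit v = orbit w"
proof
  assume "v \<in> orbit w"
  then obtain i where i: "v = rotate i w" by (auto simp: orbit_def)
  have "rotate j w \<in> orbit v" for j
  proof -
    \<comment> \<open>A rotation by \<open>length w - i mod length w\<close> completes the rotation
      by \<open>i\<close> to full turns; \<open>j\<close> further places then give the desired
      word.\<close>
    have "rotate (j + (length w - i mod length w)) v = rotate (j + (length w - i mod length w) + i) w"
      by (simp add: i rotate_rotate)
    also have "\<dots> = rotate j w"
    proof (cases "length w = 0")
      case False
      have "(j + (length w - i mod length w) + i) mod length w = j mod length w"
      proof -
        have "i mod length w \<le> length w" using mod_less_divisor[of "length w" i] False by simp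
        then have "j + (length w - i mod length w) + i = j + (length w + i div length w * length w)"
          using div_mult_mod_eq[of i "length w"] by linarith
        also have "\<dots> = j + (1 + i div length w) * length w" by simp
        finally have "j + (length w - i mod length w) + i = j + (1 + i div length w) * length w" .
        then show ?thesis by (metis mod_mult_self1)
      qed
      then show ?thesis by (metis rotate_conv_mod)
    qed simp
    finally show ?thesis unfolding orbit_def by (metis rangeI)
  qed
  then show "orbit v = orbit w"
    unfolding orbit_def[of w] by (auto simp: orbit_def i rotate_rotate)
qed (use orbit_refl in blast)

context
  fixes w :: "'a list" assumes w: "w \<noteq> []"
begin

lemma period_pos: "period w > 0" and rotate_period: "rotate (period w) w = w"
proof -
  have "length w > 0 \<and> rotate (length w) w = w" using w by simp
  from LeastI[of "\<lambda>d. d > 0 \<and> rotate d w = w", OF this]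
  show "period w > 0" "rotate (period w) w = w" by (auto simp: period_def)
qed

lemma rotate_mod_period: "rotate (d mod period w) w = rotate d w"
  using funpow_mod_eq[of "period w" rotate1 w d] rotate_period by (simp add: rotate_def)

lemma rotate_eq_iff: "rotate d w = w \<longleftrightarrow> period w dvd d"
proof
  assume "rotate d w = w"
  then have r: "rotate (d mod period w) w = w" by (simp add: rotate_mod_period)
  have "d mod period w < period w" using period_pos by simp
  then have "\<not> (d mod period w > 0 \<and> rotate (d mod period w) w = w)"
    unfolding period_def by (rule not_less_Least)
  then show "period w dvd d" using r by auto
next
  assume "period w dvd d"
  then show "rotate d w = w" using rotate_mod_period[of d] by simp
qed

lemma card_orbit: "card (orbit w) = period w"
proof -
  have "orbit w = (\<lambda>i. rotate i w) ` {..<period w}"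
    unfolding orbit_def using rotate_mod_period period_pos
    by (auto simp: image_iff) (metis lessThan_iff mod_less_divisor)
  moreover have "inj_on (\<lambda>i. rotate i w) {..<period w}"
  proof (rule linorder_inj_onI)
    fix i j assume ij: "i < j" "i \<in> {..<period w}" "j \<in> {..<period w}"
    show "rotate i w \<noteq> rotate j w"
    proof
      assume "rotate i w = rotate j w"
      \<comment> \<open>Cancelling the injective \<open>rotate1 ^^ i\<close> leaves a rotation by
        \<open>j - i\<close> that fixes \<open>w\<close>, although \<open>j - i\<close> is positive
        and smaller than the period.\<close>
      then have "(rotate1 ^^ i) w = (rotate1 ^^ i) ((rotate1 ^^ (j - i)) w)"
        using ij(1) by (simp add: rotate_def funpow_add[symmetric, THEN fun_cong, unfolded o_apply])
      moreover have "inj (rotate1 ^^ i :: 'a list \<Rightarrow> 'a list)" using inj_rotate1 by (rule inj_fn)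
      ultimately have "rotate (j - i) w = w" unfolding rotate_def by (metis injD)
      then have "period w dvd j - i" unfolding rotate_eq_iff .
      then show False using ij by (auto dest: dvd_imp_le)
    qed
  qed auto
  ultimately show ?thesis by (simp add: card_image)
qed

end

text \<open>Each fibre of \<open>q\<close> is an orbit, with as many elements as their common
  period, so the reciprocals of the periods add up to 1 on it. The map \<open>q\<close> stays
  abstract so that the projection to the quotient can be inserted later.\<close>

lemma card_rotation_classes:
  assumes X: "finite X" "\<And>w. w \<in> X \<Longrightarrow> orbit w \<subseteq> X" "[] \<notin> X"
    and q: "\<And>v w. v \<in> X \<Longrightarrow> w \<in> X \<Longrightarrow> q v = q w \<longleftrightarrow> v \<in> orbit w"
  shows "real (card (q ` X)) = (\<Sum>w\<in>X. 1 / real (period w))"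
proof -
  have "(\<Sum>w\<in>X. 1 / real (period w)) = (\<Sum>y\<in>q ` X. \<Sum>w\<in>{w\<in>X. q w = y}. 1 / real (period w))"
    by (rule sum.image_gen[OF X(1)])
  also have "\<dots> = (\<Sum>y\<in>q ` X. 1)"
  proof (intro sum.cong refl)
    fix y assume "y \<in> q ` X"
    then obtain w where w: "w \<in> X" "y = q w" by blast
    have fib: "{v\<in>X. q v = y} = orbit w"
      unfolding w(2) using X(2)[OF w(1)] w(1) q by auto
    have ne: "v \<noteq> []" if "v \<in> orbit w" for v using that X(2)[OF w(1)] X(3) by blast
    have "(\<Sum>v\<in>orbit w. 1 / real (period v)) = (\<Sum>v\<in>orbit w. 1 / real (period w))"
    proof (intro sum.cong refl)
      fix v assume v: "v \<in> orbit w"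
      then have "orbit v = orbit w" using orbit_eq by blast
      then show "1 / real (period v) = 1 / real (period w)"
        using card_orbit[OF ne[OF v]] card_orbit[OF ne[OF orbit_refl]] by simp
    qed
    also have "\<dots> = 1"
      using card_orbit[OF ne[OF orbit_refl]] period_pos[OF ne[OF orbit_refl]] by simp
    finally show "(\<Sum>v\<in>{v\<in>X. q v = y}. 1 / real (period v)) = 1" unfolding fib .
  qed
  also have "\<dots> = real (card (q ` X))" by simp
  finally show ?thesis by simp
qed

section \<open>Words fixed by a rotation\<close>

text \<open>As \<open>v\<close> begins with \<open>u\<close>, one copy of \<open>u\<close> can be
  peeled off, and the rest again commutes with \<open>u\<close>.\<close>

lemma commuting_words:
  assumes "u @ v = v @ u" "length v = q * length u"
  shows "v = concat (replicate q u)"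
  using assms
proof (induction q arbitrary: v)
  case (Suc q)
  have "length u \<le> length v" using Suc.prems by simp
  then obtain v' where v': "v = u @ v'"
    using Suc.prems(1) by (metis append_eq_append_conv_if append_take_drop_id)
  have "v' = concat (replicate q u)" by (rule Suc.IH) (use Suc.prems v' in simp_all)
  then show ?case using v' by simp
qed simp

text \<open>Rotation by \<open>d\<close> exchanges the prefix of length \<open>d\<close> with the
  rest, so a fixed word is one whose prefix and rest commute.\<close>

lemma rotate_fixed_iff:
  assumes "length w = q * d" "w \<noteq> []"
  shows "rotate d w = w \<longleftrightarrow> w = concat (replicate q (take d w))"
proof -
  obtain p where p: "q = Suc p" using assms by (cases q) auto
  let ?u = "take d w"
  have u: "length ?u = d" using assms(1) p by simp
  show ?thesis
  proof
    assume r: "rotate d w = w"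
    have rot: "rotate d w = drop d w @ ?u"
    proof (cases "d = length w")
      case False
      then have "d < length w" using assms(1) p by simp
      then show ?thesis by (simp add: rotate_drop_take)
    qed simp
    have "?u @ drop d w = drop d w @ ?u" using r rot by simp
    then have "drop d w = concat (replicate p ?u)"
      by (rule commuting_words) (use assms(1) p u in simp)
    then show "w = concat (replicate q ?u)" using append_take_drop_id[of d w] p by simp
  next
    assume eq: "w = concat (replicate q ?u)"
    then have 1: "w = ?u @ concat (replicate p ?u)" using p by simp
    have "rotate d w = concat (replicate p ?u) @ ?u"
      using rotate_append[of ?u "concat (replicate p ?u)"] 1 u by metis
    also have "\<dots> = concat (replicate q ?u)"
      unfolding p by (induction p) simp_all
    finally show "rotate d w = w" using eq by simp
  qed
qed

definition words :: "nat \<Rightarrow> nat \<Rightarrow> letter list set"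
  where "words n m = {w. length w = n \<and> count_list w LX = m}"

lemma finite_words: "finite (words n m)"
proof (rule finite_subset)
  show "words n m \<subseteq> {w. set w \<subseteq> {LX, LXs} \<and> length w = n}"
    using letter.exhaust by (auto simp: words_def)
qed (rule finite_lists_length_eq, simp)

lemma card_words: "card (words n m) = n choose m"
proof (induction n arbitrary: m)
  case 0
  have "words 0 m = (if m = 0 then {[]} else {})" by (auto simp: words_def)
  then show ?case by (cases m) auto
next
  case (Suc n)
  have split: "words (Suc n) m = Cons LXs ` words n m \<union> (if m = 0 then {} else Cons LX ` words n (m - 1))"
    (is "_ = ?R")
  proof (intro set_eqI iffI)
    fix w assume "w \<in> words (Suc n) m"
    then show "w \<in> ?R"
      by (cases w; cases "hd w") (auto simp: words_def)
  qed (auto simp: words_def split: if_splits)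
  show ?case
  proof (cases m)
    case 0
    then show ?thesis using split Suc.IH[of 0] by (simp add: card_image)
  next
    case (Suc j)
    have "card (words (Suc n) m) = card (Cons LXs ` words n m) + card (Cons LX ` words n j)"
      using split Suc card_Un_disjoint[of "Cons LXs ` words n m" "Cons LX ` words n j"] finite_words
      by auto
    then show ?thesis using Suc.IH Suc by (simp add: card_image)
  qed
qed

lemma count_list_rotate: "count_list (rotate i w) x = count_list w x"
proof (induction i)
  case (Suc i)
  have "count_list (rotate1 v) x = count_list v x" for v by (cases v) auto
  then show ?case using Suc by simp
qed simp

lemma orbit_words: "w \<in> words n m \<Longrightarrow> orbit w \<subseteq> words n m"
  by (auto simp: orbit_def words_def count_list_rotate)

lemma count_list_concat_replicate: "count_list (concat (replicate q u)) x = q * count_list u x"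
  by (induction q) auto

text \<open>With \<open>n = q * d\<close>, the root of such a power has
  \<open>m / q = d m / n\<close> letters \<open>LX\<close>. This is the lower entry of the binomial
  coefficient, and its integrality is the divisibility condition.\<close>

lemma card_rotate_fixed_words:
  assumes n: "n > 0" "d dvd n"
  shows "card {w\<in>words n m. rotate d w = w} = (if n dvd d * m then d choose (d * m div n) else 0)"
proof -
  obtain q where q: "n = q * d" using n(2) by (metis dvd_def mult.commute)
  have pos: "q > 0" "d > 0" using n(1) q by auto
  let ?P = "\<lambda>u. concat (replicate q u)"
  have fixed: "{w\<in>words n m. rotate d w = w} = ?P ` {u. length u = d \<and> q * count_list u LX = m}"
  proof (intro set_eqI iffI)
    fix w assume "w \<in> {w\<in>words n m. rotate d w = w}"
    then have w: "length w = n" "count_list w LX = m" "rotate d w = w" by (auto simp: words_def)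
    have "w \<noteq> []" using w(1) n(1) by auto
    then have "w = ?P (take d w)" using rotate_fixed_iff[of w q d] w q by simp
    moreover have "length (take d w) = d" using w(1) q pos by simp
    moreover have "q * count_list (take d w) LX = m"
      using w(2) calculation(1) count_list_concat_replicate by metis
    ultimately show "w \<in> ?P ` {u. length u = d \<and> q * count_list u LX = m}" by blast
  next
    fix w assume "w \<in> ?P ` {u. length u = d \<and> q * count_list u LX = m}"
    then obtain u where u: "w = ?P u" "length u = d" "q * count_list u LX = m" by blast
    have len: "length w = q * d" using u by (simp add: length_concat sum_list_replicate)
    have "take d w = u" using u pos by (cases q) auto
    then have "rotate d w = w" using rotate_fixed_iff[OF len] u(1) by (cases "w = []") auto
    then show "w \<in> {w\<in>words n m. rotate d w = w}"
      using u len q by (simp add: words_def count_list_concat_replicate)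
  qed
  have inj: "inj_on ?P {u. length u = d \<and> q * count_list u LX = m}"
  proof (rule inj_onI)
    fix u v assume "u \<in> {u. length u = d \<and> q * count_list u LX = m}"
      "v \<in> {u. length u = d \<and> q * count_list u LX = m}" "?P u = ?P v"
    then show "u = v" using pos by (cases q) auto
  qed
  have dvd: "n dvd d * m \<longleftrightarrow> q dvd m" unfolding q using pos by (simp add: mult.commute)
  show ?thesis
  proof (cases "q dvd m")
    case True
    then obtain c where c: "m = q * c" by auto
    have "{u. length u = d \<and> q * count_list u LX = m} = words d c"
      using pos c by (auto simp: words_def)
    moreover have "d * m = n * c" unfolding q c by (simp only: ac_simps)
    then have "d * m div n = c" using n(1) by simp
    ultimately show ?thesis
      unfolding fixed card_image[OF inj] using True dvd card_words by simp
  next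
    case False
    then have empty: "{u. length u = d \<and> q * count_list u LX = m} = {}" by auto
    show ?thesis unfolding fixed empty using False dvd by simp
  qed
qed

section \<open>Counting necklaces\<close>

text \<open>The inner sum is the Moebius inversion of \<open>F\<close>, the number of words fixed by
  a rotation, and yields \<open>p l\<close>, the number of words of exact period \<open>l\<close>.
  The indices absent from the formula contribute 0.\<close>

lemma necklace_correction_eq:
  assumes n: "n > 0"
  shows "necklace_correction n (int m)
    = (\<Sum>l | l dvd n. (real l - 1) / real l * real (card {w\<in>words n m. period w = l}))"
proof -
  define p where "p l = card {w\<in>words n m. period w = l}" for l
  define F where "F d = card {w\<in>words n m. rotate d w = w}" for d
  have ne: "w \<noteq> []" if "w \<in> words n m" for w using that n by (auto simp: words_def)
  have Fp: "F d = (\<Sum>l | l dvd d. p l)" if "d > 0" for d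
  proof -
    have "{w\<in>words n m. rotate d w = w} = (\<Union>l\<in>{l. l dvd d}. {w\<in>words n m. period w = l})"
      using rotate_eq_iff[OF ne] by auto
    then show ?thesis
      unfolding F_def p_def using that finite_words[of n m]
      by (simp only:) (rule card_UN_disjoint, auto)
  qed
  have inner: "(\<Sum>k | k > 0 \<and> int k dvd gcd (int l) (int l * int m div int n).
      of_int (moebius_mu k) * real (binom_int (l div k) (int l * int m div (int k * int n)))) = real (p l)"
    if l: "l dvd n" "n dvd l * m" for l
  proof -
    have lpos: "l > 0" using l(1) n by (auto intro: Nat.gr0I)
    obtain c where c: "l * m = n * c" using l(2) by auto
    have lc: "int l * int m div int n = int c" using c n by (metis nonzero_mult_div_cancel_left of_nat_mult of_nat_eq_0_iff less_irrefl)
    have "real (p l) = (\<Sum>k | k dvd l. of_int (moebius_mu k) * real (F (l div k)))"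
    proof (rule moebius_inversion[symmetric, OF lpos])
      fix d assume "d dvd l"
      then have "d > 0" using lpos by (auto intro: Nat.gr0I)
      then show "real (F d) = (\<Sum>l | l dvd d. real (p l))" using Fp by simp
    qed
    also have "\<dots> = (\<Sum>k | k dvd l \<and> k dvd c. of_int (moebius_mu k) * real (F (l div k)))"
    proof (rule sum.mono_neutral_right)
      show "finite {k. k dvd l}" using lpos by simp
      show "\<forall>k\<in>{k. k dvd l} - {k. k dvd l \<and> k dvd c}. of_int (moebius_mu k) * real (F (l div k)) = 0"
      proof
        fix k assume k: "k \<in> {k. k dvd l} - {k. k dvd l \<and> k dvd c}"
        then obtain d where d: "l = k * d" by auto
        then have kd: "k > 0" "l div k = d" "d dvd n" using lpos l(1) by (auto dest: dvd_mult_right)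
        \<comment> \<open>A word fixed by rotation by \<open>d = l div k\<close> has a root with
          \<open>d m / n = c / k\<close> letters \<open>LX\<close>, so there is none unless
          \<open>k\<close> divides \<open>c\<close>.\<close>
        have "\<not> n dvd d * m"
        proof
          assume "n dvd d * m"
          then obtain e where "d * m = n * e" by auto
          then have "n * c = n * (k * e)" using c d by (metis mult.assoc mult.left_commute)
          then have "k dvd c" using n by simp
          then show False using k by simp
        qed
        then have "F (l div k) = 0" unfolding F_def kd(2) using card_rotate_fixed_words[OF n kd(3)] by simp
        then show "of_int (moebius_mu k) * real (F (l div k)) = 0" by simp
      qed
    qed auto
    also have "\<dots> = (\<Sum>k | k > 0 \<and> int k dvd gcd (int l) (int l * int m div int n).
      of_int (moebius_mu k) * real (binom_int (l div k) (int l * int m div (int k * int n))))"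
    proof (rule sum.cong)
      show "{k. k dvd l \<and> k dvd c} = {k. k > 0 \<and> int k dvd gcd (int l) (int l * int m div int n)}"
        unfolding lc using lpos by (auto intro: Nat.gr0I)
      fix k assume "k \<in> {k. k > 0 \<and> int k dvd gcd (int l) (int l * int m div int n)}"
      then have k: "k > 0" "k dvd l" "k dvd c" unfolding lc by auto
      obtain d where d: "l = k * d" using k(2) by auto
      obtain b where b: "c = k * b" using k(3) by auto
      have ld: "l div k = d" "d dvd n" using d k(1) l(1) by (auto dest: dvd_mult_right)
      have "k * (d * m) = k * (n * b)" using c d b by (simp add: ac_simps)
      then have dm: "d * m = n * b" using k(1) by simp
      have "int l * int m = (int k * int n) * int b"
        unfolding of_nat_mult[symmetric] using c b by (simp add: ac_simps)
      then have "int l * int m div (int k * int n) = int b" using k(1) n by simp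
      then show "of_int (moebius_mu k) * real (F (l div k))
        = of_int (moebius_mu k) * real (binom_int (l div k) (int l * int m div (int k * int n)))"
        unfolding F_def ld(1) card_rotate_fixed_words[OF n ld(2)] using dm n by (simp add: binom_int_def)
    qed
    finally show ?thesis by simp
  qed
  have p0: "p l = 0" if l: "l dvd n" "\<not> n dvd l * m" for l
  proof -
    have "l > 0" using l(1) n by (auto intro: Nat.gr0I)
    \<comment> \<open>A word of period \<open>l\<close> is in particular fixed by rotation by
      \<open>l\<close>, and no word is when \<open>n\<close> does not divide
      \<open>l * m\<close>.\<close>
    then have "p l \<le> F l" unfolding Fp[OF \<open>l > 0\<close>] by (intro member_le_sum) auto
    also have "F l = 0" unfolding F_def using card_rotate_fixed_words[OF n l(1)] l(2) by simp
    finally show ?thesis by simp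
  qed
  have dvd: "int n dvd int l * int m \<longleftrightarrow> n dvd l * m" for l
    by (metis int_dvd_int_iff of_nat_mult)
  have "necklace_correction n (int m) = (\<Sum>l | l dvd n \<and> n dvd l * m. (real l - 1) / real l * real (p l))"
    unfolding necklace_correction_def dvd using inner n
    by (intro sum.cong) (auto intro: Nat.gr0I)
  also have "\<dots> = (\<Sum>l | l dvd n. (real l - 1) / real l * real (p l))"
    by (rule sum.mono_neutral_left) (use n p0 in auto)
  finally show ?thesis unfolding p_def .
qed

lemma card_necklaces:
  assumes n: "n > 0"
    and q: "\<And>v w. v \<in> words n m \<Longrightarrow> w \<in> words n m \<Longrightarrow> q v = q w \<longleftrightarrow> v \<in> orbit w"
  shows "real (card (q ` words n m)) = real (n choose m) - necklace_correction n (int m)"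
proof -
  have ne: "w \<noteq> []" if "w \<in> words n m" for w using that n by (auto simp: words_def)
  have per: "period w dvd n" if "w \<in> words n m" for w
    using rotate_eq_iff[OF ne[OF that], of n] that by (simp add: words_def)
  have group: "(\<Sum>w\<in>words n m. h (period w)) = (\<Sum>l | l dvd n. h l * real (card {w\<in>words n m. period w = l}))"
    for h :: "nat \<Rightarrow> real"
  proof -
    have "(\<Sum>w\<in>words n m. h (period w)) = (\<Sum>l | l dvd n. \<Sum>w\<in>{w\<in>words n m. period w = l}. h (period w))"
      by (rule sum.group[symmetric]) (use finite_words n per in auto)
    then show ?thesis by (simp add: mult.commute)
  qed
  have "real (card (q ` words n m)) = (\<Sum>w\<in>words n m. 1 / real (period w))"
    by (rule card_rotation_classes[OF finite_words orbit_words _ q]) (use ne in auto)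
  also have "\<dots> = (\<Sum>w\<in>words n m. 1 - (real (period w) - 1) / real (period w))"
    using period_pos[OF ne] by (intro sum.cong) (auto simp: field_simps)
  also have "\<dots> = real (n choose m) - (\<Sum>w\<in>words n m. (real (period w) - 1) / real (period w))"
    by (simp add: sum_subtractf card_words)
  also have "\<dots> = real (n choose m) - necklace_correction n (int m)"
    unfolding necklace_correction_eq[OF n] group[of "\<lambda>l. (real l - 1) / real l"] ..
  finally show ?thesis .
qed

text \<open>The index -1 is the \<open>m - 1\<close> of the formula for \<open>m = 0\<close>.
  Integer division rounds down, so the lower entry stays negative and \<open>binom_int\<close>
  returns 0.\<close>

lemma necklace_correction_neg:
  assumes "n > 0"
  shows "necklace_correction n (-1) = 0"
proof -
  have "(\<Sum>k | k > 0 \<and> int k dvd gcd (int l) (int l * - 1 div int n).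
      of_int (moebius_mu k) * real (binom_int (l div k) (int l * - 1 div (int k * int n)))) = 0"
    if "l > 0" for l
  proof (rule sum.neutral, clarify)
    fix k :: nat assume "k > 0"
    then have "int l * - 1 div (int k * int n) < 0"
      using that assms by (intro div_neg_pos_less0) auto
    then show "of_int (moebius_mu k) * real (binom_int (l div k) (int l * - 1 div (int k * int n))) = 0"
      by (simp add: binom_int_def)
  qed
  then show ?thesis unfolding necklace_correction_def by (intro sum.neutral) auto
qed

section \<open>Derivations of the free algebra\<close>

definition derivation :: "(falg \<Rightarrow> falg) \<Rightarrow> bool"
  where "derivation D \<longleftrightarrow> plinear D \<and> (\<forall>b c. D (b * c) = b * D c + D b * c)"

lemma derivation_mult: "derivation D \<Longrightarrow> D (b * c) = b * D c + D b * c"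
  by (simp add: derivation_def)

lemma derivation_plinear: "derivation D \<Longrightarrow> plinear D"
  by (simp add: derivation_def)

lemma derivation_one: assumes "derivation D" shows "D 1 = 0"
  using derivation_mult[OF assms, of 1 1] by simp

lemma derivation_add: "derivation D \<Longrightarrow> D (a + b) = D a + D b"
  and derivation_scale: "derivation D \<Longrightarrow> D (pscale c a) = pscale c (D a)"
  by (simp_all add: derivation_def plinear_iff)

lemma derivation_minus: "derivation D \<Longrightarrow> D (- a) = - D a"
  using derivation_scale[of D "-1" a] by simp

lemma single_Cons:
  "Poly_Mapping.single (Word (a # w)) (1::complex) = Poly_Mapping.single (Word [a]) 1 * Poly_Mapping.single (Word w) 1"
  by (simp add: mult_single plus_xword_def)

lemma single_Nil: "Poly_Mapping.single (Word []) (1::complex) = 1"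
  by (simp add: zero_xword_def[symmetric])

lemma single_letter: "Poly_Mapping.single (Word [a]) 1 = (if a = LX then gen_x else gen_xs)"
  by (cases a) (simp_all add: gen_x_def gen_xs_def)

lemma derivation_eqI:
  assumes D: "derivation D" "derivation D'" and gen: "D gen_x = D' gen_x" "D gen_xs = D' gen_xs"
  shows "D a = D' a"
proof (rule plinear_eqI[OF derivation_plinear derivation_plinear, OF D])
  fix k :: xword
  obtain w where k: "k = Word w" by (cases k)
  show "D (Poly_Mapping.single k 1) = D' (Poly_Mapping.single k 1)"
    unfolding k
  proof (induction w)
    case Nil
    show ?case unfolding single_Nil using D by (simp add: derivation_one)
  next
    case (Cons a w)
    show ?case
      unfolding single_Cons[of a w] derivation_mult[OF D(1)] derivation_mult[OF D(2)] Cons.IH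
      using gen by (simp add: single_letter)
  qed
qed

lemma derivation_commutator:
  assumes "derivation D" "derivation D'"
  shows "derivation (\<lambda>a. D (D' a) - D' (D a))"
  unfolding derivation_def plinear_iff
  by (simp add: derivation_mult[OF assms(1)] derivation_mult[OF assms(2)]
      derivation_add[OF assms(1)] derivation_add[OF assms(2)]
      derivation_scale[OF assms(1)] derivation_scale[OF assms(2)] pm.scale_right_diff_distrib algebra_simps)

lemma derivation_pscale:
  assumes "derivation D"
  shows "derivation (\<lambda>a. pscale c (D a))"
  unfolding derivation_def plinear_iff
  by (simp add: derivation_mult[OF assms] derivation_add[OF assms] derivation_scale[OF assms]
      pm.scale_right_distrib pscale_mult_left pscale_mult_right mult.commute)

text \<open>The Hamiltonian derivation of \<open>a\<close>. The \<open>sl\<^sub>2\<close> relations hold already for derivations of the free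
  algebra, where they need only be checked on the generators.\<close>

definition ham :: "falg \<Rightarrow> falg \<Rightarrow> falg"
  where "ham a b = mu_A (double_bracket a b)"

lemma derivation_ham: "derivation (ham a)"
  unfolding derivation_def ham_def
  using mu_A_double_bracket_right_linear mu_A_double_bracket_leibniz by blast

abbreviation E_A :: falg where "E_A \<equiv> pscale (1/2) (gen_xs ^ 2)"
abbreviation F_A :: falg where "F_A \<equiv> - pscale (1/2) (gen_x ^ 2)"
abbreviation H_A :: falg where "H_A \<equiv> gen_x * gen_xs"

lemma mu_A_single_scaled: "mu_A (Poly_Mapping.single (u, v) c) = Poly_Mapping.single (u + v) c"
  by (subst (1 2) single_scale) (simp add: plinear_mu_A[unfolded plinear_iff] mu_A_single)

text \<open>The elements \<open>E_A\<close>, \<open>F_A\<close> and \<open>H_A\<close> are multiples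
  of words of length two, so this determines their action on the generators.\<close>

lemma ham_words:
  "ham (Poly_Mapping.single (Word [a, b]) 1) (Poly_Mapping.single (Word [c]) 1)
   = Poly_Mapping.single (Word [b]) (letter_pairing a c) + Poly_Mapping.single (Word [a]) (letter_pairing b c)"
  unfolding ham_def double_bracket_eq_explicit explicit_single
  by (simp add: word_bracket_def plinear_mu_A[unfolded plinear_iff] mu_A_single_scaled plus_xword_def)

lemma plinear_ham_left: "plinear (\<lambda>a. ham a b)"
  unfolding ham_def by (rule mu_A_double_bracket_left_linear)

lemma ham_scale_left: "ham (pscale c a) b = pscale c (ham a b)"
  using plinear_ham_left[of b] by (simp add: plinear_iff)

lemma ham_minus_left: "ham (- a) b = - ham a b"
  using ham_scale_left[of "-1" a b] by simp

lemma gen_products: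
  "gen_xs ^ 2 = Poly_Mapping.single (Word [LXs, LXs]) 1"
  "gen_x ^ 2 = Poly_Mapping.single (Word [LX, LX]) 1"
  "gen_x * gen_xs = Poly_Mapping.single (Word [LX, LXs]) 1"
  by (simp_all add: gen_x_def gen_xs_def power2_eq_square mult_single plus_xword_def)

text \<open>The two letters of a square contribute equally, which absorbs the factor 1/2 in
  \<open>E_A\<close> and \<open>F_A\<close>.\<close>

lemma ham_generators:
  "ham E_A gen_x = - gen_xs" "ham E_A gen_xs = 0"
  "ham F_A gen_x = 0" "ham F_A gen_xs = - gen_x"
  "ham H_A gen_x = - gen_x" "ham H_A gen_xs = gen_xs"
  unfolding gen_products
  unfolding gen_x_def gen_xs_def ham_minus_left ham_scale_left ham_words
  by (auto intro!: poly_mapping_eqI simp: lookup_single lookup_add when_def)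

lemma ham_EF: "ham E_A (ham F_A a) - ham F_A (ham E_A a) = ham H_A a"
  \<comment> \<open>The instance of \<open>derivation_scale\<close> at 0 says that a derivation maps
    0 to 0; it is needed because some generators are killed.\<close>
  by (rule derivation_eqI[OF derivation_commutator]) (simp_all add: derivation_ham ham_generators derivation_minus[OF derivation_ham] derivation_scale[OF derivation_ham, of _ 0, simplified])

lemma ham_HE: "ham H_A (ham E_A a) - ham E_A (ham H_A a) = pscale 2 (ham E_A a)"
  by (rule derivation_eqI[of "\<lambda>a. ham H_A (ham E_A a) - ham E_A (ham H_A a)" "\<lambda>a. pscale 2 (ham E_A a)",
        OF derivation_commutator derivation_pscale])
    (auto intro!: poly_mapping_eqI simp: lookup_add lookup_minus derivation_ham ham_generators derivation_minus[OF derivation_ham] derivation_scale[OF derivation_ham, of _ 0, simplified])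

lemma ham_HF: "ham H_A (ham F_A a) - ham F_A (ham H_A a) = pscale (-2) (ham F_A a)"
  by (rule derivation_eqI[of "\<lambda>a. ham H_A (ham F_A a) - ham F_A (ham H_A a)" "\<lambda>a. pscale (-2) (ham F_A a)",
        OF derivation_commutator derivation_pscale])
    (auto intro!: poly_mapping_eqI simp: lookup_add lookup_minus derivation_ham ham_generators derivation_minus[OF derivation_ham] derivation_scale[OF derivation_ham, of _ 0, simplified])

text \<open>The letters are eigenvectors, with eigenvalue -1 for \<open>LX\<close> and 1 for
  \<open>LXs\<close>, and a derivation adds the eigenvalues of the factors of a product.\<close>

lemma ham_H_word:
  "ham H_A (Poly_Mapping.single (Word w) 1)
   = pscale (of_int (int (length w) - 2 * int (count_list w LX))) (Poly_Mapping.single (Word w) 1)"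
proof (induction w)
  case Nil
  show ?case unfolding single_Nil by (simp add: derivation_one[OF derivation_ham])
next
  case (Cons a w)
  let ?c = "of_int (int (length w) - 2 * int (count_list w LX)) :: complex"
  have "ham H_A (Poly_Mapping.single (Word [a]) 1) = pscale (if a = LX then -1 else 1) (Poly_Mapping.single (Word [a]) 1)"
    by (simp add: single_letter ham_generators)
  then have "ham H_A (Poly_Mapping.single (Word (a # w)) 1)
     = pscale (?c + (if a = LX then -1 else 1)) (Poly_Mapping.single (Word (a # w)) 1)"
    unfolding single_Cons[of a w] derivation_mult[OF derivation_ham] Cons.IH
    by (simp only: pscale_mult_left pscale_mult_right pm.scale_left_distrib)
  moreover have "?c + (if a = LX then -1 else 1) = of_int (int (length (a # w)) - 2 * int (count_list (a # w) LX))"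
    by (cases a) auto
  ultimately show ?case by metis
qed

section \<open>The grading by word length\<close>

definition homog :: "nat \<Rightarrow> falg set"
  where "homog n = {a. \<forall>w\<in>Poly_Mapping.keys a. length (letters w) = n}"

lemma subspace_homog: "pm.subspace (homog n)"
proof (rule pm.subspaceI)
  fix a b assume "a \<in> homog n" "b \<in> homog n"
  then show "a + b \<in> homog n" using keys_add[of a b] by (auto simp: homog_def)
qed (auto simp: homog_def in_keys_iff)

lemma homog_mult: "a \<in> homog i \<Longrightarrow> b \<in> homog j \<Longrightarrow> a * b \<in> homog (i + j)"
  using keys_mult[of a b] by (fastforce simp: homog_def plus_xword_def)

lemma homog_single: "Poly_Mapping.single (Word w) 1 \<in> homog (length w)"
  by (simp add: homog_def)

lemma derivation_homog:
  assumes D: "derivation D" "D gen_x \<in> homog 1" "D gen_xs \<in> homog 1" and a: "a \<in> homog n"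
  shows "D a \<in> homog n"
proof -
  have word: "D (Poly_Mapping.single (Word w) 1) \<in> homog (length w)" for w
  proof (induction w)
    case Nil
    show ?case unfolding single_Nil derivation_one[OF D(1)] by (rule pm.subspace_0[OF subspace_homog])
  next
    case (Cons b w)
    have "D (Poly_Mapping.single (Word [b]) 1) \<in> homog 1" using D by (simp add: single_letter)
    then have "D (Poly_Mapping.single (Word (b # w)) 1) \<in> homog (1 + length w)"
      unfolding single_Cons[of b w] derivation_mult[OF D(1)]
      using homog_single[of "[b]"] homog_single[of w] Cons.IH
      by (intro pm.subspace_add[OF subspace_homog] homog_mult) simp_all
    then show ?case by simp
  qed
  have "D a = (\<Sum>k\<in>Poly_Mapping.keys a. pscale (Poly_Mapping.lookup a k) (D (Poly_Mapping.single k 1)))"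
    by (subst poly_mapping_expand[of a])
      (simp add: plinear_sum[OF derivation_plinear[OF D(1)]] derivation_scale[OF D(1)])
  also have "\<dots> \<in> homog n"
  proof (intro pm.subspace_sum[OF subspace_homog] pm.subspace_scale[OF subspace_homog])
    fix k assume "k \<in> Poly_Mapping.keys a"
    then have "length (letters k) = n" using a by (simp add: homog_def)
    then show "D (Poly_Mapping.single k 1) \<in> homog n" using word[of "letters k"] by simp
  qed
  finally show ?thesis .
qed

lemma ham_homog:
  assumes "a \<in> homog n"
  shows "ham E_A a \<in> homog n" "ham F_A a \<in> homog n" "ham H_A a \<in> homog n"
proof -
  have g: "gen_x \<in> homog 1" "gen_xs \<in> homog 1" "0 \<in> homog 1" "- gen_x \<in> homog 1" "- gen_xs \<in> homog 1"
    by (simp_all add: homog_def gen_x_def gen_xs_def)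
  show "ham E_A a \<in> homog n" "ham F_A a \<in> homog n" "ham H_A a \<in> homog n"
    using g by (auto intro!: derivation_homog[OF derivation_ham _ _ assms] simp: ham_generators)
qed

section \<open>The necklace Lie algebra as a module\<close>

lemma nclass_eq_iff: "nclass a = nclass b \<longleftrightarrow> a - b \<in> commutator_space"
  by transfer (simp add: comm_equiv_def)

lemma nclass_add: "nclass (a + b) = nclass a + nclass b"
  by transfer (rule comm_equiv_refl)

lemma nclass_scale: "nclass (pscale c a) = nscale c (nclass a)"
  by transfer (rule comm_equiv_refl)

lemma nclass_zero: "nclass 0 = 0"
  by transfer (rule comm_equiv_refl)

lemma nclass_diff: "nclass (a - b) = nclass a - nclass b"
  using nclass_add[of "a - b" b] by simp

lemma nclass_sum: "nclass (\<Sum>i\<in>I. a i) = (\<Sum>i\<in>I. nclass (a i))"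
  by (induction I rule: infinite_finite_induct) (simp_all add: nclass_zero nclass_add)

lemma necklace_cases: obtains a where "u = nclass a"
proof -
  have "\<exists>a. u = nclass a" by transfer (blast intro: comm_equiv_refl)
  then show ?thesis using that by blast
qed

lemma nbracket_nclass: "nbracket (nclass a) (nclass b) = nclass (ham a b)"
  unfolding ham_def by transfer (rule comm_equiv_refl)

lemma nbracket_sl2:
  "nbracket sl2_E (nclass b) = nclass (ham E_A b)"
  "nbracket sl2_F (nclass b) = nclass (ham F_A b)"
  "nbracket sl2_H (nclass b) = nclass (ham H_A b)"
  unfolding sl2_E_def sl2_F_def sl2_H_def by (rule nbracket_nclass)+

interpretation necklace_sl2: sl2_action nscale "nbracket sl2_E" "nbracket sl2_F" "nbracket sl2_H"
proof
  fix u v :: necklace and c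
  obtain a b where u: "u = nclass a" and v: "v = nclass b" by (metis necklace_cases)
  show "nbracket sl2_E (u + v) = nbracket sl2_E u + nbracket sl2_E v"
    "nbracket sl2_F (u + v) = nbracket sl2_F u + nbracket sl2_F v"
    "nbracket sl2_H (u + v) = nbracket sl2_H u + nbracket sl2_H v"
    unfolding u v nclass_add[symmetric] nbracket_sl2
    by (simp_all only: derivation_add[OF derivation_ham])
  show "nbracket sl2_E (nscale c u) = nscale c (nbracket sl2_E u)"
    "nbracket sl2_F (nscale c u) = nscale c (nbracket sl2_F u)"
    "nbracket sl2_H (nscale c u) = nscale c (nbracket sl2_H u)"
    unfolding u nclass_scale[symmetric] nbracket_sl2
    by (simp_all only: derivation_scale[OF derivation_ham])
  show "nbracket sl2_E (nbracket sl2_F u) - nbracket sl2_F (nbracket sl2_E u) = nbracket sl2_H u"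
    unfolding u nbracket_sl2 nclass_diff[symmetric] ham_EF ..
  show "nbracket sl2_H (nbracket sl2_E u) - nbracket sl2_E (nbracket sl2_H u) = nscale 2 (nbracket sl2_E u)"
    unfolding u nbracket_sl2 nclass_diff[symmetric] nclass_scale[symmetric] ham_HE ..
  show "nbracket sl2_H (nbracket sl2_F u) - nbracket sl2_F (nbracket sl2_H u) = nscale (-2) (nbracket sl2_F u)"
    unfolding u nbracket_sl2 nclass_diff[symmetric] nclass_scale[symmetric] ham_HF ..
qed

section \<open>Cyclic words as a basis of the quotient\<close>

definition cyclic_word :: "letter list \<Rightarrow> necklace"
  where "cyclic_word w = nclass (Poly_Mapping.single (Word w) 1)"

text \<open>The sum of the coefficients over a rotation class kills commutators, hence separates the cyclic words
  in the quotient. It is valued in the constants of the free algebra so that the extensionality rule for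
  linear maps between spaces of finitely supported functions applies.\<close>

definition orbit_sum :: "letter list \<Rightarrow> falg \<Rightarrow> falg"
  where "orbit_sum w = lin_ext (\<lambda>u. if letters u \<in> orbit w then 1 else 0)"

lemma orbit_append_commute: "(u :: 'a list) @ v \<in> orbit w \<longleftrightarrow> v @ u \<in> orbit w"
proof -
  have "v @ u \<in> orbit (u @ v)" for u v :: "'a list"
    unfolding orbit_def by (rule range_eqI[of _ _ "length u"]) (simp add: rotate_append)
  then have "orbit (v @ u) = orbit (u @ v)" by (simp only: orbit_eq[symmetric])
  then show ?thesis using orbit_eq[of "u @ v" w] orbit_eq[of "v @ u" w] by simp
qed

lemma plinear_orbit_sum: "plinear (orbit_sum w)"
  by (simp add: orbit_sum_def)

lemma orbit_sum_commute: "orbit_sum w (a * b) = orbit_sum w (b * a)"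
proof (rule plinear_eqI[of "\<lambda>a. orbit_sum w (a * b)" "\<lambda>a. orbit_sum w (b * a)"])
  fix u :: xword
  show "orbit_sum w (Poly_Mapping.single u 1 * b) = orbit_sum w (b * Poly_Mapping.single u 1)"
  proof (rule plinear_eqI[of "\<lambda>b. orbit_sum w (Poly_Mapping.single u 1 * b)"
        "\<lambda>b. orbit_sum w (b * Poly_Mapping.single u 1)"])
    fix v :: xword
    show "orbit_sum w (Poly_Mapping.single u 1 * Poly_Mapping.single v 1)
        = orbit_sum w (Poly_Mapping.single v 1 * Poly_Mapping.single u 1)"
      using orbit_append_commute[of "letters u" "letters v" w]
      by (simp add: mult_single orbit_sum_def plus_xword_def)
  qed (intro plinear_comp[OF plinear_orbit_sum] plinear_mult_left plinear_mult_right plinear_id)+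
qed (intro plinear_comp[OF plinear_orbit_sum] plinear_mult_left plinear_mult_right plinear_id)+

lemma orbit_sum_commutator_space:
  assumes "a \<in> commutator_space"
  shows "orbit_sum w a = 0"
proof -
  note add = plinear_orbit_sum[unfolded plinear_iff, THEN conjunct1, rule_format]
    and scale = plinear_orbit_sum[unfolded plinear_iff, THEN conjunct2, rule_format]
  have zero: "orbit_sum w 0 = 0" using scale[of w 0 0] by simp
  have "commutator_space \<subseteq> {a. orbit_sum w a = 0}"
    unfolding commutator_space_def
  proof (rule pm.span_minimal)
    show "pm.subspace {a. orbit_sum w a = 0}"
      by (rule pm.subspaceI) (simp_all add: zero add scale)
    show "{a * b - b * a |a b. True} \<subseteq> {a. orbit_sum w a = 0}"
      using plinear_diff[OF plinear_orbit_sum] orbit_sum_commute by fastforce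
  qed
  then show ?thesis using assms by blast
qed

lemma orbit_sum_word: "orbit_sum w (Poly_Mapping.single (Word v) 1) = (if v \<in> orbit w then 1 else 0)"
  by (simp add: orbit_sum_def)

text \<open>A word and its rotation are \<open>u v\<close> and \<open>v u\<close> for suitable
  factors and so differ by a commutator; conversely \<open>orbit_sum\<close> takes different values
  on words in different orbits.\<close>

lemma cyclic_word_eq_iff: "cyclic_word v = cyclic_word w \<longleftrightarrow> v \<in> orbit w"
proof
  assume "cyclic_word v = cyclic_word w"
  then have "orbit_sum w (Poly_Mapping.single (Word v) 1 - Poly_Mapping.single (Word w) 1) = 0"
    unfolding cyclic_word_def nclass_eq_iff by (rule orbit_sum_commutator_space)
  then have "orbit_sum w (Poly_Mapping.single (Word v) 1) = orbit_sum w (Poly_Mapping.single (Word w) 1)"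
    unfolding plinear_diff[OF plinear_orbit_sum] by simp
  then show "v \<in> orbit w"
    unfolding orbit_sum_word using orbit_refl[of w] by (auto split: if_splits)
next
  assume "v \<in> orbit w"
  then obtain i where i: "v = rotate i w" by (auto simp: orbit_def)
  let ?u = "take (i mod length w) w" and ?v = "drop (i mod length w) w"
  have "Poly_Mapping.single (Word v) 1 - Poly_Mapping.single (Word w) (1::complex)
    = Poly_Mapping.single (Word ?v) 1 * Poly_Mapping.single (Word ?u) 1
      - Poly_Mapping.single (Word ?u) 1 * Poly_Mapping.single (Word ?v) 1"
    by (simp add: mult_single plus_xword_def i rotate_drop_take)
  then show "cyclic_word v = cyclic_word w"
    unfolding cyclic_word_def nclass_eq_iff using commutator_in by simp
qed

definition cyclic_words :: "nat \<Rightarrow> necklace set"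
  where "cyclic_words n = cyclic_word ` {w. length w = n}"

lemma finite_cyclic_words: "finite (cyclic_words n)"
proof -
  have "{w :: letter list. length w = n} \<subseteq> {w. set w \<subseteq> {LX, LXs} \<and> length w = n}"
    using letter.exhaust by auto
  then have "finite {w :: letter list. length w = n}"
    by (rule finite_subset) (rule finite_lists_length_eq, simp)
  then show ?thesis by (simp add: cyclic_words_def)
qed

lemma necklace_deg_homog: "necklace_deg n = nclass ` homog n"
  by (simp add: necklace_deg_def homog_def)

lemma span_cyclic_words: "neck.span (cyclic_words n) = necklace_deg n"
proof
  have "neck.subspace (necklace_deg n)"
    unfolding necklace_deg_homog
  proof (rule neck.subspaceI)
    show "0 \<in> nclass ` homog n"
      using pm.subspace_0[OF subspace_homog] nclass_zero by (metis imageI)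
    fix u v c assume "u \<in> nclass ` homog n"
    then obtain a where a: "a \<in> homog n" "u = nclass a" by blast
    then show "nscale c u \<in> nclass ` homog n"
      using pm.subspace_scale[OF subspace_homog] nclass_scale by (metis imageI)
    assume "v \<in> nclass ` homog n"
    then obtain b where b: "b \<in> homog n" "v = nclass b" by blast
    then show "u + v \<in> nclass ` homog n"
      using a pm.subspace_add[OF subspace_homog] nclass_add by (metis imageI)
  qed
  moreover have "cyclic_words n \<subseteq> necklace_deg n"
    unfolding necklace_deg_homog cyclic_words_def cyclic_word_def using homog_single by blast
  ultimately show "neck.span (cyclic_words n) \<subseteq> necklace_deg n"
    by (intro neck.span_minimal)
  show "necklace_deg n \<subseteq> neck.span (cyclic_words n)"
  proof
    fix u assume "u \<in> necklace_deg n"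
    then obtain a where a: "a \<in> homog n" "u = nclass a" unfolding necklace_deg_homog by blast
    have "u = (\<Sum>k\<in>Poly_Mapping.keys a. nscale (Poly_Mapping.lookup a k) (cyclic_word (letters k)))"
      unfolding a(2) by (subst poly_mapping_expand[of a]) (simp add: nclass_sum nclass_scale cyclic_word_def)
    also have "\<dots> \<in> neck.span (cyclic_words n)"
      using a(1) by (intro neck.span_sum neck.span_scale neck.span_base) (auto simp: homog_def cyclic_words_def)
    finally show "u \<in> neck.span (cyclic_words n)" .
  qed
qed

lemma independent_cyclic_words: "neck.independent (cyclic_words n)"
proof (rule neck.independent_if_scalars_zero[OF finite_cyclic_words])
  fix c x assume sum: "(\<Sum>b\<in>cyclic_words n. nscale (c b) b) = 0" and x: "x \<in> cyclic_words n"
  \<comment> \<open>A representative word for each cyclic word lifts the relation to the free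
    algebra, where it becomes an element of the commutator space. The functional
    \<open>orbit_sum (r x)\<close> then reads off the coefficient of \<open>x\<close>.\<close>
  define r where "r b = (SOME w. cyclic_word w = b)" for b
  have r: "cyclic_word (r b) = b" if "b \<in> cyclic_words n" for b
    unfolding r_def using that by (intro someI_ex[of "\<lambda>w. cyclic_word w = b"]) (auto simp: cyclic_words_def)
  let ?a = "\<Sum>b\<in>cyclic_words n. pscale (c b) (Poly_Mapping.single (Word (r b)) 1)"
  have "nclass ?a = (\<Sum>b\<in>cyclic_words n. nscale (c b) b)"
    unfolding nclass_sum nclass_scale cyclic_word_def[symmetric] using r by (intro sum.cong) auto
  then have "?a - 0 \<in> commutator_space"
    using sum nclass_zero nclass_eq_iff by metis
  then have "orbit_sum (r x) ?a = 0" using orbit_sum_commutator_space by simp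
  moreover have "orbit_sum (r x) ?a = (\<Sum>b\<in>cyclic_words n. if b = x then pscale (c x) 1 else 0)"
    unfolding plinear_sum[OF plinear_orbit_sum]
  proof (intro sum.cong refl)
    fix b assume b: "b \<in> cyclic_words n"
    have "r b \<in> orbit (r x) \<longleftrightarrow> b = x"
      using cyclic_word_eq_iff[of "r b" "r x"] r[OF b] r[OF x] by simp
    then show "orbit_sum (r x) (pscale (c b) (Poly_Mapping.single (Word (r b)) 1))
        = (if b = x then pscale (c x) 1 else 0)"
      using plinear_orbit_sum[of "r x"] by (simp add: plinear_iff orbit_sum_word)
  qed
  ultimately have "pscale (c x) (1 :: falg) = 0" using finite_cyclic_words x by simp
  then have "Poly_Mapping.lookup (pscale (c x) (1 :: falg)) 0 = 0" by simp
  then show "c x = 0" by simp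
qed

lemma sl2_module_necklace_deg:
  "sl2_module nscale (nbracket sl2_E) (nbracket sl2_F) (nbracket sl2_H) (necklace_deg n)"
proof -
  have "neck.subspace (necklace_deg n)" unfolding span_cyclic_words[symmetric] by simp
  then show ?thesis
    unfolding necklace_sl2.sl2_module_iff necklace_deg_homog using ham_homog by (auto simp: nbracket_sl2)
qed

text \<open>Well defined, since rotation preserves the number of letters; a junk value outside the cyclic words.\<close>

definition x_count :: "necklace \<Rightarrow> nat"
  where "x_count u = (THE m. \<exists>w. cyclic_word w = u \<and> count_list w LX = m)"

lemma x_count_cyclic_word: "x_count (cyclic_word w) = count_list w LX"
  unfolding x_count_def
proof (rule the_equality)
  fix m assume "\<exists>v. cyclic_word v = cyclic_word w \<and> count_list v LX = m"
  then show "m = count_list w LX"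
    unfolding cyclic_word_eq_iff by (auto simp: orbit_def count_list_rotate)
qed blast

lemma nbracket_H_cyclic_word:
  assumes "b \<in> cyclic_words n"
  shows "nbracket sl2_H b = nscale (of_int (int n - 2 * int (x_count b))) b"
proof -
  obtain w where w: "length w = n" "b = cyclic_word w" using assms by (auto simp: cyclic_words_def)
  show ?thesis
    unfolding w(2) x_count_cyclic_word w(1)[symmetric]
    unfolding cyclic_word_def nbracket_sl2 ham_H_word nclass_scale ..
qed

lemma cyclic_words_x_count: "{b\<in>cyclic_words n. x_count b = m} = cyclic_word ` words n m"
  by (auto simp: cyclic_words_def words_def x_count_cyclic_word)

theorem theorem5:
  fixes n m :: nat
  assumes "n \<ge> 1" and "2 * m \<le> n"
  shows "(\<exists>\<W>. sl2_decomposition nscale (nbracket sl2_E) (nbracket sl2_F) (nbracket sl2_H)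
            (necklace_deg n) \<W>) \<and>
    (\<forall>\<W>. sl2_decomposition nscale (nbracket sl2_E) (nbracket sl2_F) (nbracket sl2_H)
            (necklace_deg n) \<W> \<longrightarrow>
       real (card {W \<in> \<W>. sl2_V nscale (nbracket sl2_E) (nbracket sl2_F) (nbracket sl2_H)
                (n - 2 * m) W})
       = real (n choose m) - real (binom_int n (int m - 1))
         - necklace_correction n (int m) + necklace_correction n (int m - 1))"
proof (intro conjI allI impI)
  note weights = finite_cyclic_words[of n] nbracket_H_cyclic_word[of _ n]
  note U = sl2_module_necklace_deg[of n, folded span_cyclic_words]
  show "\<exists>\<W>. sl2_decomposition nscale (nbracket sl2_E) (nbracket sl2_F) (nbracket sl2_H) (necklace_deg n) \<W>"
    using necklace_sl2.exists_sl2_decomposition[OF weights U] unfolding span_cyclic_words .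
  fix \<W>
  assume "sl2_decomposition nscale (nbracket sl2_E) (nbracket sl2_F) (nbracket sl2_H) (necklace_deg n) \<W>"
  note \<W> = this[folded span_cyclic_words]
  define N where "N k = card {b\<in>cyclic_words n. x_count b = k}" for k
  have N: "real (N k) = real (n choose k) - necklace_correction n (int k)" for k
    unfolding N_def cyclic_words_x_count using assms(1)
    by (intro card_necklaces cyclic_word_eq_iff) simp
  \<comment> \<open>As \<open>2 * m \<le> n\<close>, the subtraction in \<open>nat\<close> is exact,
    and weight \<open>n - 2 m\<close> means \<open>m\<close> letters \<open>LX\<close>.\<close>
  have top: "{b\<in>cyclic_words n. int n - 2 * int (x_count b) = int (n - 2 * m)} = {b\<in>cyclic_words n. x_count b = m}"
    using assms(2) by auto
  let ?V = "{W \<in> \<W>. sl2_V nscale (nbracket sl2_E) (nbracket sl2_F) (nbracket sl2_H) (n - 2 * m) W}"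
  have count: "card ?V + card {b\<in>cyclic_words n. int n - 2 * int (x_count b) = int (n - 2 * m) + 2} = N m"
    using necklace_sl2.card_sl2_V_eq[OF weights independent_cyclic_words U \<W>, of "n - 2 * m"]
    unfolding top N_def .
  show "real (card ?V) = real (n choose m) - real (binom_int n (int m - 1))
         - necklace_correction n (int m) + necklace_correction n (int m - 1)"
  proof (cases m)
    case 0
    \<comment> \<open>The weight \<open>n + 2\<close> would require -1 letters
      \<open>LX\<close>.\<close>
    then have "{b\<in>cyclic_words n. int n - 2 * int (x_count b) = int (n - 2 * m) + 2} = {}" by auto
    then have "card ?V = N 0" using count 0 by simp
    then show ?thesis using N[of 0] necklace_correction_neg assms(1) 0 by (simp add: binom_int_def)
  next
    case (Suc k)
    \<comment> \<open>Raising the weight by 2 means one letter \<open>LX\<close> less, that is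
      \<open>k = m - 1\<close>.\<close>
    then have "{b\<in>cyclic_words n. int n - 2 * int (x_count b) = int (n - 2 * m) + 2} = {b\<in>cyclic_words n. x_count b = k}"
      using assms(2) by auto
    then have "real (card ?V) + real (N k) = real (N m)"
      unfolding of_nat_add[symmetric] using count N_def by simp
    then show ?thesis using N[of k] N[of m] Suc by (simp add: binom_int_def)
  qed
qed

end
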